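(* Let $A_n(t,\lambda,y,w)$ be the polynomials defined by the J-type continued fraction in the context. For every $n\ge 0$, $$A_n(t,\lambda,y,w)=\sum_{\sigma\in\mathfrak S_n}t^{\mathrm{exc}\,\sigma}\lambda^{\mathrm{pex}\,\sigma}y^{\mathrm{ear}\,\sigma}w^{\mathrm{fix}\,\sigma}=\sum_{\sigma\in\mathfrak S_n}t^{\mathrm{exc}\,\sigma}\lambda^{\mathrm{pcyc}\,\sigma}y^{\mathrm{ear}\,\sigma}w^{\mathrm{fix}\,\sigma}=\sum_{\sigma\in\mathfrak S_n}t^{\mathrm{exc}\,\sigma}\lambda^{\mathrm{pcyc}\,\sigma}y^{\mathrm{pex}\,\sigma}w^{\mathrm{fix}\,\sigma}.$$
   Context: Polynomials: $A_n(t,\lambda,y,w)$ ($n\ge0$) are defined by the identity of formal power series in $z$ $$\sum_{n\ge0}A_n(t,\lambda,y,w)z^n=\cfrac{1}{1-\gamma_0z-\cfrac{\beta_1z^2}{1-\gamma_1z-\cfrac{\beta_2z^2}{\cdots}}},\qquad \gamma_n=w+n(t+1)\ (n\ge 0),\quad \beta_n=t(\lambda+n-1)(y+n-1)\ (n\ge1).$$ $\mathfrak S_n$ is the set of permutations $\sigma$ of $[n]=\{1,\dots,n\}$ ($\mathfrak S_0$ consists of the empty permutation). For $\sigma\in\mathfrak S_n$: - $\mathrm{exc}\,\sigma$ is the number of excedances, i.e. $i\in[n]$ with $\sigma(i)>i$. - $\mathrm{pex}\,\sigma$ is the number of pure excedances, i.e. $i$ such that $\sigma(i)>i$ and $\sigma(j)\notin[i,\sigma(i)]$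 for all $j<i$. - $\mathrm{cyc}\,\sigma$ is the number of cycles of $\sigma$ (fixed points included), $\mathrm{fix}\,\sigma$ the number of fixed points, and $\mathrm{pcyc}\,\sigma=\mathrm{cyc}\,\sigma-\mathrm{fix}\,\sigma$. - An index $i$ is a record if $\sigma(j)<\sigma(i)$ for all $j<i$; an antirecord if $\sigma(j)>\sigma(i)$ for all $j>i$; an exclusive antirecord if it is an antirecord and not a record; a cycle peak if $\sigma^{-1}(i)<i>\sigma(i)$. $\mathrm{ear}\,\sigma$ is the number of $i\in[n]$ that are both an exclusive antirecord and a cycle peak. *)

theory Defs
  imports
    "HOL-Computational_Algebra.Formal_Power_Series"
    "HOL-Combinatorics.Permutations"
    "HOL-Combinatorics.Orbits"
begin

section \<open>J-type continued fractions\<close>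

text \<open>
  Coefficients live in an arbitrary commutative ring, where formal power series have no
  \<^const>\<open>inverse\<close> operation. All denominators below have constant coefficient 1, and
  the inverse of such a series is \<open>fps_left_inverse f 1\<close>.
\<close>

definition fps_recip :: "'a::comm_ring_1 fps \<Rightarrow> 'a fps" where
  "fps_recip f = fps_left_inverse f 1"

lemma fps_recip_mult:
  assumes "fps_nth f 0 = 1"
  shows "fps_recip f * f = 1"
  unfolding fps_recip_def by (rule fps_left_inverse) (simp add: assms)

text \<open>
  \<open>jfrac_conv \<gamma> \<beta> h\<close> is the continued fraction truncated at level \<open>h\<close>, i.e. with
  \<open>\<beta> (h + 1) = 0\<close>. The value \<open>\<beta> 0\<close> is never used.
\<close>

primrec jfrac_conv :: "(nat \<Rightarrow> 'a::comm_ring_1) \<Rightarrow> (nat \<Rightarrow> 'a) \<Rightarrow> nat \<Rightarrow> 'a fps" where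
  "jfrac_conv \<gamma> \<beta> 0 = fps_recip (1 - fps_const (\<gamma> 0) * fps_X)"
| "jfrac_conv \<gamma> \<beta> (Suc h) =
     fps_recip (1 - fps_const (\<gamma> 0) * fps_X
       - fps_const (\<beta> 1) * fps_X ^ 2 * jfrac_conv (\<lambda>n. \<gamma> (Suc n)) (\<lambda>n. \<beta> (Suc n)) h)"

text \<open>
  The infinite continued fraction is the limit of the truncations in the usual
  (\<open>z\<close>-adic) topology on formal power series.
\<close>

definition jfrac :: "(nat \<Rightarrow> 'a::comm_ring_1) \<Rightarrow> (nat \<Rightarrow> 'a) \<Rightarrow> 'a fps" where
  "jfrac \<gamma> \<beta> = lim (jfrac_conv \<gamma> \<beta>)"

lemma fps_recip_nth_cong:
  assumes "\<And>k. k \<le> n \<Longrightarrow> fps_nth f k = fps_nth g k" and "m \<le> n"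
  shows "fps_nth (fps_recip f) m = fps_nth (fps_recip g) m"
  using \<open>m \<le> n\<close>
proof (induction m rule: less_induct)
  case (less m)
  show ?case
  proof (cases m)
    case 0
    then show ?thesis by (simp add: fps_recip_def)
  next
    case (Suc m')
    have "(\<Sum>i = 0..m'. fps_nth (fps_recip f) i * fps_nth f (Suc m' - i)) =
          (\<Sum>i = 0..m'. fps_nth (fps_recip g) i * fps_nth g (Suc m' - i))"
      using less Suc assms(1) by (intro sum.cong) auto
    then show ?thesis using Suc by (simp add: fps_recip_def)
  qed
qed

lemma jfrac_denom_nth_cong:
  fixes f g :: "'a::comm_ring_1 fps"
  assumes "\<And>k. k + 2 \<le> n \<Longrightarrow> fps_nth f k = fps_nth g k" and "m \<le> n"
  shows "fps_nth (1 - fps_const a * fps_X - fps_const b * fps_X ^ 2 * f) m =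
         fps_nth (1 - fps_const a * fps_X - fps_const b * fps_X ^ 2 * g) m"
  using assms by (simp add: mult.assoc fps_X_power_mult_nth)

lemma jfrac_conv_Suc_nth:
  "m \<le> 2 * h + 1 \<Longrightarrow> fps_nth (jfrac_conv \<gamma> \<beta> (Suc h)) m = fps_nth (jfrac_conv \<gamma> \<beta> h) m"
proof (induction h arbitrary: \<gamma> \<beta> m)
  case 0
  show ?case
    unfolding jfrac_conv.simps
    by (rule fps_recip_nth_cong[where n = 1])
       (use 0 in \<open>simp_all add: mult.assoc fps_X_power_mult_nth\<close>)
next
  case (Suc h)
  show ?case
    unfolding jfrac_conv.simps(2)[of \<gamma> \<beta> "Suc h"] jfrac_conv.simps(2)[of \<gamma> \<beta> h]
    by (rule fps_recip_nth_cong[OF jfrac_denom_nth_cong[where n = "2 * Suc h + 1"]])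
       (use Suc in simp_all)
qed

lemma jfrac_conv_nth_stable:
  assumes "m \<le> h"
  shows "fps_nth (jfrac_conv \<gamma> \<beta> h) m = fps_nth (jfrac_conv \<gamma> \<beta> m) m"
  using assms
proof (induction h rule: dec_induct)
  case (step h)
  then show ?case using jfrac_conv_Suc_nth[of m h \<gamma> \<beta>] by simp
qed simp

lemma jfrac_conv_tendsto: "jfrac_conv \<gamma> \<beta> \<longlonglongrightarrow> jfrac \<gamma> \<beta>"
proof -
  have "jfrac_conv \<gamma> \<beta> \<longlonglongrightarrow> Abs_fps (\<lambda>n. fps_nth (jfrac_conv \<gamma> \<beta> n) n)"
  proof (rule tendsto_fpsI)
    fix n
    show "\<forall>\<^sub>F h in sequentially. fps_nth (jfrac_conv \<gamma> \<beta> h) n =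
            fps_nth (Abs_fps (\<lambda>n. fps_nth (jfrac_conv \<gamma> \<beta> n) n)) n"
      unfolding eventually_sequentially fps_nth_Abs_fps using jfrac_conv_nth_stable by blast
  qed
  then show ?thesis unfolding jfrac_def by (simp add: limI)
qed

lemma jfrac_nth:
  assumes "n \<le> h"
  shows "fps_nth (jfrac \<gamma> \<beta>) n = fps_nth (jfrac_conv \<gamma> \<beta> h) n"
proof -
  have "\<forall>\<^sub>F k in sequentially. fps_nth (jfrac_conv \<gamma> \<beta> k) n = fps_nth (jfrac \<gamma> \<beta>) n"
    using jfrac_conv_tendsto[of \<gamma> \<beta>] unfolding tendsto_fps_iff by blast
  then obtain N where "\<And>k. k \<ge> N \<Longrightarrow> fps_nth (jfrac_conv \<gamma> \<beta> k) n = fps_nth (jfrac \<gamma> \<beta>) n"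
    unfolding eventually_sequentially by blast
  from this[of "max N h"] show ?thesis
    using jfrac_conv_nth_stable[of n "max N h" \<gamma> \<beta>] jfrac_conv_nth_stable[OF assms, of \<gamma> \<beta>] assms
    by simp
qed

lemma jfrac_unfold:
  "jfrac \<gamma> \<beta> * (1 - fps_const (\<gamma> 0) * fps_X
     - fps_const (\<beta> 1) * fps_X ^ 2 * jfrac (\<lambda>n. \<gamma> (Suc n)) (\<lambda>n. \<beta> (Suc n))) = 1"
proof -
  let ?D = "\<lambda>f. 1 - fps_const (\<gamma> 0) * fps_X - fps_const (\<beta> 1) * fps_X ^ 2 * f"
  let ?J = "jfrac (\<lambda>n. \<gamma> (Suc n)) (\<lambda>n. \<beta> (Suc n))"
  have "jfrac \<gamma> \<beta> = fps_recip (?D ?J)"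
  proof (rule fps_ext)
    fix n
    have "fps_nth (jfrac \<gamma> \<beta>) n = fps_nth (jfrac_conv \<gamma> \<beta> (Suc n)) n"
      by (rule jfrac_nth) simp
    also have "\<dots> = fps_nth (fps_recip (?D ?J)) n"
      unfolding jfrac_conv.simps(2)
      by (rule fps_recip_nth_cong[OF jfrac_denom_nth_cong[where n = n]])
         (auto intro!: jfrac_nth[symmetric])
    finally show "fps_nth (jfrac \<gamma> \<beta>) n = fps_nth (fps_recip (?D ?J)) n" .
  qed
  moreover have "fps_nth (?D ?J) 0 = 1"
    by (simp add: mult.assoc fps_X_power_mult_nth)
  ultimately show ?thesis by (simp add: fps_recip_mult)
qed

section \<open>The polynomials\<close>

text \<open>
  \<open>A n t l y w\<close> is the value of \<open>A\<^sub>n(t, \<lambda>, y, w)\<close> at arbitrary elements of an arbitrary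
  commutative ring. The polynomial itself is obtained by taking for \<open>t\<close>, \<open>l\<close>, \<open>y\<close>, \<open>w\<close> the
  indeterminates of a polynomial ring over the integers, so an identity that holds for all
  elements of all commutative rings comprises the identity of polynomials.
\<close>

definition A_gamma :: "'a::comm_ring_1 \<Rightarrow> 'a \<Rightarrow> nat \<Rightarrow> 'a" where
  "A_gamma t w n = w + of_nat n * (t + 1)"

definition A_beta :: "'a::comm_ring_1 \<Rightarrow> 'a \<Rightarrow> 'a \<Rightarrow> nat \<Rightarrow> 'a" where
  "A_beta t l y n = t * (l + of_nat n - 1) * (y + of_nat n - 1)"

definition A :: "nat \<Rightarrow> 'a::comm_ring_1 \<Rightarrow> 'a \<Rightarrow> 'a \<Rightarrow> 'a \<Rightarrow> 'a" where
  "A n t l y w = fps_nth (jfrac (A_gamma t w) (A_beta t l y)) n"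

section \<open>Permutation statistics\<close>

text \<open>
  A permutation of \<open>[n]\<close> is a function \<open>\<sigma>\<close> with \<open>\<sigma> permutes {1..n}\<close>; since it is the identity
  outside \<open>{1..n}\<close>, each statistic takes \<open>n\<close> as an explicit argument.
\<close>

definition exc :: "nat \<Rightarrow> (nat \<Rightarrow> nat) \<Rightarrow> nat" where
  "exc n \<sigma> = card {i \<in> {1..n}. \<sigma> i > i}"

definition pex :: "nat \<Rightarrow> (nat \<Rightarrow> nat) \<Rightarrow> nat" where
  "pex n \<sigma> = card {i \<in> {1..n}. \<sigma> i > i \<and> (\<forall>j \<in> {1..n}. j < i \<longrightarrow> \<sigma> j \<notin> {i..\<sigma> i})}"

definition cyc :: "nat \<Rightarrow> (nat \<Rightarrow> nat) \<Rightarrow> nat" where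
  "cyc n \<sigma> = card (orbit \<sigma> ` {1..n})"

definition fix_num :: "nat \<Rightarrow> (nat \<Rightarrow> nat) \<Rightarrow> nat" where
  "fix_num n \<sigma> = card {i \<in> {1..n}. \<sigma> i = i}"

definition pcyc :: "nat \<Rightarrow> (nat \<Rightarrow> nat) \<Rightarrow> nat" where
  "pcyc n \<sigma> = cyc n \<sigma> - fix_num n \<sigma>"

text \<open>The subtraction in \<open>pcyc\<close> is never truncated.\<close>

lemma fix_num_le_cyc: "fix_num n \<sigma> \<le> cyc n \<sigma>"
proof -
  let ?F = "{i \<in> {1..n}. \<sigma> i = i}"
  have orb: "orbit \<sigma> i = {i}" if "\<sigma> i = i" for i
  proof -
    have "j = i" if "j \<in> orbit \<sigma> i" for j
      using that by induction (use \<open>\<sigma> i = i\<close> in auto)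
    moreover have "i \<in> orbit \<sigma> i"
      using orbit.base[of \<sigma> i] \<open>\<sigma> i = i\<close> by simp
    ultimately show ?thesis by blast
  qed
  have "inj_on (orbit \<sigma>) ?F" using orb by (auto simp: inj_on_def)
  then have "card ?F = card (orbit \<sigma> ` ?F)" by (simp add: card_image)
  also have "\<dots> \<le> card (orbit \<sigma> ` {1..n})" by (intro card_mono) auto
  finally show ?thesis by (simp add: fix_num_def cyc_def)
qed

definition is_record :: "nat \<Rightarrow> (nat \<Rightarrow> nat) \<Rightarrow> nat \<Rightarrow> bool" where
  "is_record n \<sigma> i \<longleftrightarrow> (\<forall>j \<in> {1..n}. j < i \<longrightarrow> \<sigma> j < \<sigma> i)"

definition is_antirecord :: "nat \<Rightarrow> (nat \<Rightarrow> nat) \<Rightarrow> nat \<Rightarrow> bool" where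
  "is_antirecord n \<sigma> i \<longleftrightarrow> (\<forall>j \<in> {1..n}. j > i \<longrightarrow> \<sigma> j > \<sigma> i)"

definition is_exclusive_antirecord :: "nat \<Rightarrow> (nat \<Rightarrow> nat) \<Rightarrow> nat \<Rightarrow> bool" where
  "is_exclusive_antirecord n \<sigma> i \<longleftrightarrow> is_antirecord n \<sigma> i \<and> \<not> is_record n \<sigma> i"

definition is_cycle_peak :: "(nat \<Rightarrow> nat) \<Rightarrow> nat \<Rightarrow> bool" where
  "is_cycle_peak \<sigma> i \<longleftrightarrow> inv \<sigma> i < i \<and> i > \<sigma> i"

definition ear :: "nat \<Rightarrow> (nat \<Rightarrow> nat) \<Rightarrow> nat" where
  "ear n \<sigma> = card {i \<in> {1..n}. is_exclusive_antirecord n \<sigma> i \<and> is_cycle_peak \<sigma> i}"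

end

theory Submission
  imports Defs
begin

text \<open>
  A permutation is built by inserting \<open>1, 2, \<dots>, n\<close> in turn into a partial permutation of
  \<open>[n]\<close> with \<open>h\<close> elements lacking an image and \<open>h\<close> elements lacking a preimage. A new element
  is isolated, is a fixed point, extends one chain at its end or at its start, or is a cycle peak, which
  joins one of the \<open>h\<close> free sources to one of the \<open>h\<close> free targets. If among the \<open>h\<close> sources
  (respectively targets) exactly one is marked by \<open>\<lambda>\<close> (respectively \<open>y\<close>), then a peak
  contributes \<open>t (\<lambda> + h - 1) (y + h - 1)\<close>, and the sum of all weights is the coefficient of the
  continued fraction. The peak \<open>i\<close> counts for \<open>ear\<close> iff \<open>\<sigma>(i)\<close> is the first free target, and
  it closes a cycle iff its source is the end of the chain that starts at \<open>\<sigma>(i)\<close>. If instead the last free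
  source is marked, one counts the excedances \<open>a\<close> such that no arc leads from \<open>[a, \<sigma>(a)]\<close> beyond
  \<open>\<sigma>(a)\<close>. These copure excedances correspond to pure ones in two ways. The involution
  \<open>\<sigma> \<mapsto> r \<sigma>\<^sup>-\<^sup>1 r\<close> with \<open>r(i) = n + 1 - i\<close> exchanges them and preserves \<open>exc\<close>, \<open>fix\<close>
  and \<open>pcyc\<close>. Moreover, once the weak anti-excedances (which determine \<open>ear\<close> and \<open>fix\<close>) are fixed,
  the excedances form an arbitrary increasing matching \<open>S \<rightarrow> T\<close>, and the generating
  functions of pure and copure arcs over such matchings are both products of local factors, over the up steps
  and over the down steps of the same lattice path.
\<close>

section \<open>Weighted paths and the continued fraction\<close>

text \<open>The hypotheses on \<open>T\<close> are the last-step recurrence of Motzkin paths with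
  weight 1 for a step up, \<open>\<gamma>\<close> for a level step and \<open>\<beta>\<close> for a
  step down. The product of the shifted fractions up to \<open>h\<close>, times the power
  \<open>h\<close> of the variable, satisfies the same recurrence coefficient by
  coefficient.\<close>

lemma jfrac_nth_eq_path_table:
  fixes T :: "nat \<Rightarrow> nat \<Rightarrow> 'a::comm_ring_1"
  assumes init: "\<And>h. T 0 h = (if h = 0 then 1 else 0)"
    and zero: "\<And>n. T (Suc n) 0 = \<gamma> 0 * T n 0 + \<beta> 1 * T n 1"
    and suc: "\<And>n h. T (Suc n) (Suc h) =
      T n h + \<gamma> (Suc h) * T n (Suc h) + \<beta> (Suc (Suc h)) * T n (Suc (Suc h))"
  shows "fps_nth (jfrac \<gamma> \<beta>) n = T n 0"
proof -
  define J where "J k = jfrac (\<lambda>n. \<gamma> (n + k)) (\<lambda>n. \<beta> (n + k))" for k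
  \<comment> \<open>\<open>G h\<close> is the generating function of the paths from height \<open>0\<close> to height \<open>h\<close>.\<close>
  define G where "G h = fps_X ^ h * (\<Prod>k\<le>h. J k)" for h
  \<comment> \<open>The functional equation multiplied out and solved for \<open>J k\<close>, with
    factors \<open>fps_X\<close> in front so that coefficients can be read off.\<close>
  have J: "J k = 1 + fps_X * (fps_const (\<gamma> k) * J k)
      + fps_X * (fps_const (\<beta> (Suc k)) * (fps_X * (J k * J (Suc k))))" for k
    using jfrac_unfold[of "\<lambda>n. \<gamma> (n + k)" "\<lambda>n. \<beta> (n + k)"]
    by (simp add: J_def algebra_simps power2_eq_square)
  have G0: "G 0 = 1 + fps_X * (fps_const (\<gamma> 0) * G 0 + fps_const (\<beta> 1) * G 1)"
    unfolding G_def using J[of 0] by (simp add: algebra_simps)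
  have GS: "G (Suc h) = fps_X * (G h + fps_const (\<gamma> (Suc h)) * G (Suc h)
      + fps_const (\<beta> (Suc (Suc h))) * G (Suc (Suc h)))" for h
  proof -
    have "G (Suc h) = fps_X * (G h * J (Suc h))"
      by (simp add: G_def mult_ac)
    also have "\<dots> = fps_X * (G h * (1 + fps_X * (fps_const (\<gamma> (Suc h)) * J (Suc h))
      + fps_X * (fps_const (\<beta> (Suc (Suc h))) * (fps_X * (J (Suc h) * J (Suc (Suc h)))))))"
      by (simp only: J[of "Suc h", symmetric])
    also have "\<dots> = fps_X * (G h + fps_const (\<gamma> (Suc h)) * G (Suc h)
      + fps_const (\<beta> (Suc (Suc h))) * G (Suc (Suc h)))"
      by (simp add: G_def algebra_simps)
    finally show ?thesis .
  qed
  have "fps_nth (G h) n = T n h" for h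
  proof (induction n arbitrary: h)
    case 0
    show ?case
    proof (cases h)
      case 0
      \<comment> \<open>The left sides of \<open>G0\<close> and \<open>GS\<close> recur on the
        right, so each is unfolded exactly once.\<close>
      then show ?thesis by (subst \<open>h = 0\<close>, subst G0) (simp add: init)
    next
      case (Suc k)
      then show ?thesis by (subst Suc, subst GS) (simp add: init)
    qed
  next
    case (Suc n)
    show ?case
    proof (cases h)
      case 0
      then show ?thesis by (subst \<open>h = 0\<close>, subst G0) (simp add: zero Suc)
    next
      case (Suc k)
      then show ?thesis by (subst Suc, subst GS) (simp add: suc Suc.IH)
    qed
  qed
  from this[of 0] show ?thesis by (simp add: G_def J_def)
qed

text \<open>Source of the factors \<open>\<lambda> + h\<close> and \<open>y + h\<close> of
  \<open>\<beta> (h + 1)\<close>.\<close>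

lemma sum_one_marked:
  fixes x :: "'a::comm_ring_1"
  assumes "finite S" and "\<exists>!s. s \<in> S \<and> P s" and "card S = Suc h"
  shows "(\<Sum>s\<in>S. if P s then x else 1) = x + of_nat h"
proof -
  obtain s where s: "s \<in> S" "P s" "\<And>s'. s' \<in> S - {s} \<Longrightarrow> \<not> P s'"
    using ex1E[OF assms(2)] by (metis DiffE singletonI)
  have "(\<Sum>s\<in>S. if P s then x else 1) = x + (\<Sum>s\<in>S - {s}. if P s then x else 1)"
    using s assms(1) by (subst sum.remove[of _ s]) auto
  also have "(\<Sum>s\<in>S - {s}. if P s then x else 1) = (\<Sum>s\<in>S - {s}. 1)"
    using s by (intro sum.cong) auto
  finally show ?thesis using s assms by simp
qed

section \<open>Partial permutations\<close>

text \<open>With relations, inversion, restriction to a smaller square and insertion of an arc are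
  set operations, and sources and targets play symmetric roles.\<close>

definition partial_perms :: "nat \<Rightarrow> (nat \<times> nat) set set" where
  "partial_perms n = {R. R \<subseteq> {1..n} \<times> {1..n} \<and> single_valued R \<and> single_valued (R\<inverse>)}"

lemma finite_partial_perms [simp]: "finite (partial_perms n)"
  by (rule finite_subset[of _ "Pow ({1..n} \<times> {1..n})"]) (auto simp: partial_perms_def)

lemma card_Domain: "single_valued R \<Longrightarrow> finite R \<Longrightarrow> card (Domain R) = card R"
  by (subst Domain_fst, rule card_image) (force simp: inj_on_def single_valued_def)

lemma card_Range: "single_valued (R\<inverse>) \<Longrightarrow> finite R \<Longrightarrow> card (Range R) = card R"
  by (subst Range_snd, rule card_image) (force simp: inj_on_def single_valued_def)

lemma partial_perms_finite: "R \<in> partial_perms n \<Longrightarrow> finite R"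
  unfolding partial_perms_def by (auto intro: finite_subset)

lemma card_free_sources:
  assumes "R \<in> partial_perms n"
  shows "card ({1..n} - Domain R) = n - card R"
  using assms card_Domain[of R] partial_perms_finite[OF assms]
  by (subst card_Diff_subset) (auto simp: partial_perms_def finite_Domain)

lemma card_free_targets:
  assumes "R \<in> partial_perms n"
  shows "card ({1..n} - Range R) = n - card R"
  using assms card_Range[of R] partial_perms_finite[OF assms]
  by (subst card_Diff_subset) (auto simp: partial_perms_def finite_Range)

lemma card_partial_perm_le:
  assumes "R \<in> partial_perms n"
  shows "card R \<le> n"
proof -
  have "card (Domain R) \<le> card {1..n}"
    using assms by (intro card_mono) (auto simp: partial_perms_def)
  then show ?thesis
    using assms card_Domain[of R] partial_perms_finite[OF assms] by (simp add: partial_perms_def)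
qed

section \<open>Insertion of a new largest element\<close>

text \<open>The cases are the steps of a Motzkin path whose height is the number of free sources: an
  isolated element raises it, a loop or a single new arc keeps it, and two new arcs lower
  it.\<close>

definition extensions :: "nat \<Rightarrow> (nat \<times> nat) set \<Rightarrow> (nat \<times> nat) set set" where
  "extensions n R = {R, insert (Suc n, Suc n) R}
    \<union> (\<lambda>s. insert (s, Suc n) R) ` ({1..n} - Domain R)
    \<union> (\<lambda>v. insert (Suc n, v) R) ` ({1..n} - Range R)
    \<union> (\<lambda>(s, v). insert (s, Suc n) (insert (Suc n, v) R)) `
        (({1..n} - Domain R) \<times> ({1..n} - Range R))"

lemma partial_perms_insert:
  assumes "R \<in> partial_perms n" "a \<notin> Domain R" "b \<notin> Range R" "a \<in> {1..n}" "b \<in> {1..n}"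
  shows "insert (a, b) R \<in> partial_perms n"
proof -
  have "single_valued (insert (a, b) R)" "single_valued ((insert (a, b) R)\<inverse>)"
    using assms unfolding partial_perms_def single_valued_def by blast+
  then show ?thesis using assms by (auto simp: partial_perms_def)
qed

text \<open>Restriction to the old square forgets the new element. Its fibres are the sets of
  extensions, so sums over partial permutations of \<open>Suc n\<close> can be grouped by what they
  induce on \<open>n\<close>.\<close>

lemma extensions_iff:
  assumes R: "R \<in> partial_perms n"
  shows "R' \<in> extensions n R \<longleftrightarrow> R' \<in> partial_perms (Suc n) \<and> R' \<inter> {1..n} \<times> {1..n} = R"
proof
  let ?m = "Suc n"
  have R_m: "R \<in> partial_perms ?m" "R \<inter> {1..n} \<times> {1..n} = R" "?m \<notin> Domain R" "?m \<notin> Range R"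
    using R by (auto simp: partial_perms_def)
  assume "R' \<in> extensions n R"
  then consider "R' = R" | "R' = insert (?m, ?m) R"
    | s where "s \<in> {1..n} - Domain R" "R' = insert (s, ?m) R"
    | v where "v \<in> {1..n} - Range R" "R' = insert (?m, v) R"
    | s v where "s \<in> {1..n} - Domain R" "v \<in> {1..n} - Range R"
        "R' = insert (s, ?m) (insert (?m, v) R)"
    unfolding extensions_def by (elim UnE insertE imageE SigmaE emptyE) simp_all
  then show "R' \<in> partial_perms ?m \<and> R' \<inter> {1..n} \<times> {1..n} = R"
    by cases (use R_m in \<open>auto intro!: partial_perms_insert\<close>)
next
  assume R': "R' \<in> partial_perms (Suc n) \<and> R' \<inter> {1..n} \<times> {1..n} = R"
  let ?m = "Suc n"
  have sub: "R' \<subseteq> {1..?m} \<times> {1..?m}" and eq: "R = R' \<inter> {1..n} \<times> {1..n}"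
    and sv: "\<And>a b c. (a, b) \<in> R' \<Longrightarrow> (a, c) \<in> R' \<Longrightarrow> b = c"
    and sv': "\<And>a b c. (b, a) \<in> R' \<Longrightarrow> (c, a) \<in> R' \<Longrightarrow> b = c"
    using R' by (auto simp: partial_perms_def single_valued_def)
  have split: "R' = R \<union> {p \<in> R'. fst p = ?m \<or> snd p = ?m}"
    using sub unfolding eq by (force simp: le_Suc_eq)
  have bd: "\<And>a b. (a, b) \<in> R' \<Longrightarrow> 1 \<le> a \<and> a \<le> ?m \<and> 1 \<le> b \<and> b \<le> ?m" using sub by auto
  have R_sub: "\<And>a b. (a, b) \<in> R \<Longrightarrow> (a, b) \<in> R' \<and> a \<le> n \<and> b \<le> n"
    unfolding eq by auto
  have src: "s \<in> {1..n} - Domain R" if "(s, ?m) \<in> R'" "s \<noteq> ?m" for s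
  proof -
    have "s \<notin> Domain R" using that sv R_sub by (metis DomainE Suc_n_not_le_n)
    then show ?thesis using that bd[of s ?m] by auto
  qed
  have tgt: "v \<in> {1..n} - Range R" if "(?m, v) \<in> R'" "v \<noteq> ?m" for v
  proof -
    have "v \<notin> Range R" using that sv' R_sub by (metis RangeE Suc_n_not_le_n)
    then show ?thesis using that bd[of ?m v] by auto
  qed
  consider (a) "\<And>s. (s, ?m) \<notin> R'" "\<And>v. (?m, v) \<notin> R'"
    | (b) "(?m, ?m) \<in> R'"
    | (c) s where "(s, ?m) \<in> R'" "s \<noteq> ?m" "\<And>v. (?m, v) \<notin> R'"
    | (d) v where "(?m, v) \<in> R'" "v \<noteq> ?m" "\<And>s. (s, ?m) \<notin> R'"
    | (e) s v where "(s, ?m) \<in> R'" "(?m, v) \<in> R'" "s \<noteq> ?m" "v \<noteq> ?m"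
    by metis
  then show "R' \<in> extensions n R"
  proof cases
    case a
    then have "R' = R" using split by auto
    then show ?thesis by (simp add: extensions_def)
  next
    case b
    then have "{p \<in> R'. fst p = ?m \<or> snd p = ?m} = {(?m, ?m)}" using sv sv' by auto
    then have "R' = insert (?m, ?m) R" using split by simp
    then show ?thesis by (simp add: extensions_def)
  next
    case c
    then have "{p \<in> R'. fst p = ?m \<or> snd p = ?m} = {(s, ?m)}" using sv' by auto
    then have "R' = insert (s, ?m) R" using split by simp
    moreover have "s \<in> {1..n} - Domain R"
      using c src by blast
    ultimately show ?thesis by (auto simp: extensions_def)
  next
    case d
    then have "{p \<in> R'. fst p = ?m \<or> snd p = ?m} = {(?m, v)}" using sv by auto
    then have "R' = insert (?m, v) R" using split by simp
    moreover have "v \<in> {1..n} - Range R"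
      using d tgt by blast
    ultimately show ?thesis by (auto simp: extensions_def)
  next
    case e
    then have "{p \<in> R'. fst p = ?m \<or> snd p = ?m} = {(s, ?m), (?m, v)}" using sv sv' by auto
    then have "R' = insert (s, ?m) (insert (?m, v) R)" using split by simp
    moreover have "s \<in> {1..n} - Domain R"
      using e src by blast
    moreover have "v \<in> {1..n} - Range R"
      using e tgt by blast
    ultimately show ?thesis by (auto simp: extensions_def)
  qed
qed

lemma sum_extensions:
  assumes R: "R \<in> partial_perms n"
  defines "S \<equiv> {1..n} - Domain R" and "V \<equiv> {1..n} - Range R"
  shows "(\<Sum>R' \<in> extensions n R. F R') = F R + F (insert (Suc n, Suc n) R)
    + (\<Sum>s\<in>S. F (insert (s, Suc n) R)) + (\<Sum>v\<in>V. F (insert (Suc n, v) R))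
    + (\<Sum>s\<in>S. \<Sum>v\<in>V. F (insert (s, Suc n) (insert (Suc n, v) R)))"
proof -
  let ?m = "Suc n"
  let ?c = "\<lambda>s. insert (s, ?m) R" and ?d = "\<lambda>v. insert (?m, v) R"
    and ?e = "\<lambda>(s, v). insert (s, ?m) (insert (?m, v) R)"
  have m: "(s, ?m) \<notin> R" "(?m, s) \<notin> R" for s
    using R by (auto simp: partial_perms_def)
  have S: "?m \<notin> S" "?m \<notin> V" "finite S" "finite V" by (auto simp: S_def V_def)
  have ic: "inj_on ?c S"
  proof (rule inj_onI)
    fix s s' assume "?c s = ?c s'"
    then have "(s, ?m) \<in> ?c s'" by blast
    then show "s = s'" using m by simp
  qed
  have id: "inj_on ?d V"
  proof (rule inj_onI)
    fix v v' assume "?d v = ?d v'"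
    then have "(?m, v) \<in> ?d v'" by blast
    then show "v = v'" using m by simp
  qed
  have ie: "inj_on ?e (S \<times> V)"
  proof (rule inj_onI, clarify)
    fix s v s' v' assume *: "s \<in> S" "v \<in> V" "s' \<in> S" "v' \<in> V"
      "insert (s, ?m) (insert (?m, v) R) = insert (s', ?m) (insert (?m, v') R)"
    then have "(s, ?m) \<in> insert (s', ?m) (insert (?m, v') R)"
      "(?m, v) \<in> insert (s', ?m) (insert (?m, v') R)" by blast+
    then show "s = s' \<and> v = v'" using m S * by auto
  qed
  \<comment> \<open>An arc from an older element into the new one (\<open>p\<close>) and an arc from
    the new one to an older element (\<open>q\<close>): their four combinations separate the
    families \<open>X\<close>, \<open>C\<close>, \<open>D\<close>, \<open>E\<close>.\<close>
  define p where "p R' \<longleftrightarrow> (\<exists>s\<le>n. (s, ?m) \<in> R')" for R'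
  define q where "q R' \<longleftrightarrow> (\<exists>v\<le>n. (?m, v) \<in> R')" for R'
  define X where "X = {R, insert (?m, ?m) R}"
  define C where "C = ?c ` S"
  define D where "D = ?d ` V"
  define E where "E = ?e ` (S \<times> V)"
  have kX: "\<forall>R' \<in> X. \<not> p R' \<and> \<not> q R'"
    using m by (auto simp: p_def q_def X_def)
  have kC: "\<forall>R' \<in> C. p R' \<and> \<not> q R'"
    using m by (auto simp: p_def q_def C_def S_def)
  have kD: "\<forall>R' \<in> D. \<not> p R' \<and> q R'"
    using m by (auto simp: p_def q_def D_def V_def)
  have kE: "\<forall>R' \<in> E. p R' \<and> q R'"
    by (auto simp: p_def q_def E_def S_def V_def)
  have fin: "finite X" "finite C" "finite D" "finite E"
    using S by (auto simp: X_def C_def D_def E_def)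
  have "extensions n R = X \<union> C \<union> D \<union> E"
    by (simp add: extensions_def X_def C_def D_def E_def S_def V_def)
  moreover have "X \<inter> C = {}" "(X \<union> C) \<inter> D = {}" "(X \<union> C \<union> D) \<inter> E = {}"
    using kX kC kD kE by blast+
  ultimately have "(\<Sum>R' \<in> extensions n R. F R') = sum F X + sum F C + sum F D + sum F E"
    using fin by (simp add: sum.union_disjoint)
  moreover have "R \<noteq> insert (?m, ?m) R" using m by blast
  then have "sum F X = F R + F (insert (?m, ?m) R)" by (simp add: X_def)
  moreover have "sum F C = (\<Sum>s\<in>S. F (?c s))" using ic by (simp add: C_def sum.reindex)
  moreover have "sum F D = (\<Sum>v\<in>V. F (?d v))" using id by (simp add: D_def sum.reindex)
  moreover have "sum F E = (\<Sum>s\<in>S. \<Sum>v\<in>V. F (insert (s, ?m) (insert (?m, v) R)))"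
    using ie by (simp add: E_def sum.reindex sum.cartesian_product case_prod_unfold)
  ultimately show ?thesis by simp
qed

text \<open>
  \<open>Q\<close> selects, at a cycle peak \<open>i\<close>, certain pairs of the preimage and the image of \<open>i\<close> in terms of the
  partial permutation that is left on \<open>[i - 1]\<close>.
\<close>

definition cycle_peak_with ::
  "(nat \<Rightarrow> (nat \<times> nat) set \<Rightarrow> nat \<Rightarrow> nat \<Rightarrow> bool) \<Rightarrow> nat \<Rightarrow> (nat \<times> nat) set \<Rightarrow> bool" where
  "cycle_peak_with Q i R \<longleftrightarrow> (\<exists>s<i. \<exists>v<i. (s, i) \<in> R \<and> (i, v) \<in> R \<and>
     Q (i - 1) (R \<inter> {1..<i} \<times> {1..<i}) s v)"

text \<open>For a free source \<open>s\<close> this makes \<open>s\<close> the largest one; the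
  inclusion avoids the maximum of a possibly empty set. \<open>first_target\<close> treats the least
  free target in the same way.\<close>

definition last_source :: "nat \<Rightarrow> (nat \<times> nat) set \<Rightarrow> nat \<Rightarrow> nat \<Rightarrow> bool" where
  "last_source n R s v \<longleftrightarrow> {s<..n} \<subseteq> Domain R"

definition first_target :: "nat \<Rightarrow> (nat \<times> nat) set \<Rightarrow> nat \<Rightarrow> nat \<Rightarrow> bool" where
  "first_target n R s v \<longleftrightarrow> {1..<v} \<subseteq> Range R"

text \<open>The chain starting at \<open>v\<close> reaches \<open>s\<close>, so a new element placed
  between \<open>s\<close> and \<open>v\<close> closes a cycle. The reflexive closure covers the
  one-element chain \<open>v = s\<close>.\<close>

definition joined :: "nat \<Rightarrow> (nat \<times> nat) set \<Rightarrow> nat \<Rightarrow> nat \<Rightarrow> bool" where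
  "joined n R s v \<longleftrightarrow> (v, s) \<in> R\<^sup>*"

section \<open>Exactly one marked choice\<close>

lemma ex1_last_source:
  assumes "{1..n} - Domain R \<noteq> {}"
  shows "\<exists>!s. s \<in> {1..n} - Domain R \<and> last_source n R s v"
proof
  let ?S = "{1..n} - Domain R"
  have M: "Max ?S \<in> ?S" using assms by (intro Max_in) auto
  show "Max ?S \<in> ?S \<and> last_source n R (Max ?S) v"
  proof
    show "Max ?S \<in> ?S" by (rule M)
    show "last_source n R (Max ?S) v"
      unfolding last_source_def
    proof
      fix c assume c: "c \<in> {Max ?S<..n}"
      show "c \<in> Domain R"
      proof (rule ccontr)
        assume "c \<notin> Domain R"
        then have "c \<in> ?S" using c M by auto
        then have "c \<le> Max ?S" by (intro Max_ge) auto
        then show False using c by auto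
      qed
    qed
  qed
  fix s assume s: "s \<in> ?S \<and> last_source n R s v"
  then have "s \<le> Max ?S" by (intro Max_ge) auto
  moreover have "\<not> s < Max ?S"
  proof
    assume "s < Max ?S"
    then have "Max ?S \<in> {s<..n}" using M by auto
    then show False using s M unfolding last_source_def by blast
  qed
  ultimately show "s = Max ?S" by simp
qed

lemma ex1_first_target:
  assumes "{1..n} - Range R \<noteq> {}"
  shows "\<exists>!v. v \<in> {1..n} - Range R \<and> first_target n R s v"
proof
  let ?V = "{1..n} - Range R"
  have M: "Min ?V \<in> ?V" using assms by (intro Min_in) auto
  show "Min ?V \<in> ?V \<and> first_target n R s (Min ?V)"
  proof
    show "Min ?V \<in> ?V" by (rule M)
    show "first_target n R s (Min ?V)"
      unfolding first_target_def
    proof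
      fix c assume c: "c \<in> {1..<Min ?V}"
      show "c \<in> Range R"
      proof (rule ccontr)
        assume "c \<notin> Range R"
        then have "c \<in> ?V" using c M by auto
        then have "Min ?V \<le> c" by (intro Min_le) auto
        then show False using c by auto
      qed
    qed
  qed
  fix v assume v: "v \<in> ?V \<and> first_target n R s v"
  then have "Min ?V \<le> v" by (intro Min_le) auto
  moreover have "\<not> Min ?V < v"
  proof
    assume "Min ?V < v"
    then have "Min ?V \<in> {1..<v}" using M by auto
    then show False using v M unfolding first_target_def by blast
  qed
  ultimately show "v = Min ?V" by simp
qed

text \<open>If the chain from \<open>v\<close> had no end, the successor map would inject the finite
  set of points reachable from \<open>v\<close> into that set without \<open>v\<close>, which has no
  preimage. Two ends agree because of any two points of the chain one is reachable from the
  other.\<close>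

lemma ex1_chain_end:
  assumes "single_valued R" "single_valued (R\<inverse>)" "finite R" "v \<notin> Range R"
  shows "\<exists>!s. s \<notin> Domain R \<and> (v, s) \<in> R\<^sup>*"
proof -
  let ?X = "R\<^sup>* `` {v}" and ?f = "\<lambda>x. THE y. (x, y) \<in> R"
  have fin: "finite ?X"
    by (rule finite_subset[of _ "insert v (Range R)"])
      (use assms(3) in \<open>auto simp: finite_Range elim: rtranclE\<close>)
  have f: "?f x = y" if "(x, y) \<in> R" for x y
    using that assms(1) by (auto simp: single_valued_def)
  have "\<exists>s. s \<in> ?X \<and> s \<notin> Domain R"
  proof (rule ccontr)
    assume "\<not> ?thesis"
    then have dom: "\<And>x. x \<in> ?X \<Longrightarrow> (x, ?f x) \<in> R" using f by (metis DomainE)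
    then have "?f ` ?X \<subseteq> ?X - {v}" using assms(4) by (auto intro: rtrancl_into_rtrancl)
    then have "card (?f ` ?X) < card ?X"
      using fin by (intro psubset_card_mono) auto
    moreover have "inj_on ?f ?X"
    proof (rule inj_onI)
      fix x x' assume "x \<in> ?X" "x' \<in> ?X" "?f x = ?f x'"
      then have "(x, ?f x) \<in> R" "(x', ?f x) \<in> R" using dom by metis+
      then show "x = x'" using assms(2) unfolding single_valued_def by (meson converse_iff)
    qed
    ultimately show False by (simp add: card_image)
  qed
  moreover have "s = s'"
    if "s \<notin> Domain R" "(v, s) \<in> R\<^sup>*" "s' \<notin> Domain R" "(v, s') \<in> R\<^sup>*" for s s'
    using single_valued_confluent[OF assms(1) that(2,4)] that(1,3)
    by (metis Domain.DomainI converse_rtranclE)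
  ultimately show ?thesis by blast
qed

lemma ex1_joined_source:
  assumes R: "R \<in> partial_perms n" and v: "v \<in> {1..n} - Range R"
  shows "\<exists>!s. s \<in> {1..n} - Domain R \<and> joined n R s v"
proof -
  have sub: "R \<subseteq> {1..n} \<times> {1..n}" and sv: "single_valued R" "single_valued (R\<inverse>)"
    using R by (auto simp: partial_perms_def)
  have "s \<in> {1..n}" if "(v, s) \<in> R\<^sup>*" for s
    using that by (cases rule: rtranclE) (use v sub in auto)
  moreover have "\<exists>!s. s \<notin> Domain R \<and> (v, s) \<in> R\<^sup>*"
    using ex1_chain_end[OF sv partial_perms_finite[OF R]] v by blast
  ultimately show ?thesis unfolding joined_def by blast
qed

text \<open>The statement about sources, applied to the converse relation.\<close>

lemma ex1_joined_target:
  assumes R: "R \<in> partial_perms n" and s: "s \<in> {1..n} - Domain R"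
  shows "\<exists>!v. v \<in> {1..n} - Range R \<and> joined n R s v"
proof -
  have "R\<inverse> \<in> partial_perms n" "s \<in> {1..n} - Range (R\<inverse>)"
    using R s by (auto simp: partial_perms_def)
  from ex1_joined_source[OF this] show ?thesis by (simp add: joined_def rtrancl_converse)
qed

section \<open>Weights and the path recurrence\<close>

text \<open>The weight that \<open>i\<close> contributes at its insertion. An excedance pays
  \<open>t\<close> at its value, the larger end, since only then is the arc present.\<close>

definition arc_weight ::
  "(nat \<Rightarrow> (nat \<times> nat) set \<Rightarrow> nat \<Rightarrow> nat \<Rightarrow> bool) \<Rightarrow> (nat \<Rightarrow> (nat \<times> nat) set \<Rightarrow> nat \<Rightarrow> nat \<Rightarrow> bool)
    \<Rightarrow> 'a::comm_ring_1 \<Rightarrow> 'a \<Rightarrow> 'a \<Rightarrow> 'a \<Rightarrow> nat \<Rightarrow> (nat \<times> nat) set \<Rightarrow> 'a" where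
  "arc_weight Q Q' t l y w i R =
     (if \<exists>s<i. (s, i) \<in> R then t else 1) * (if cycle_peak_with Q i R then l else 1) *
     (if cycle_peak_with Q' i R then y else 1) * (if (i, i) \<in> R then w else 1)"

text \<open>Later insertions leave the weight of \<open>i\<close> unchanged. The conditions on 0 are
  there because the bounds \<open>s < i\<close> and \<open>v < i\<close> in the weight admit 0,
  which lies outside the square.\<close>

lemma arc_weight_cong:
  assumes "R \<inter> {1..i} \<times> {1..i} = R' \<inter> {1..i} \<times> {1..i}" "0 \<notin> Domain R" "0 \<notin> Domain R'"
    "0 \<notin> Range R" "0 \<notin> Range R'"
  shows "arc_weight Q Q' t l y w i R = arc_weight Q Q' t l y w i R'"
proof -
  have eq: "(a, b) \<in> R \<longleftrightarrow> (a, b) \<in> R'" if "a \<le> i" "b \<le> i" for a b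
  proof (cases "a = 0 \<or> b = 0")
    case True
    then show ?thesis using assms(2-5) by auto
  next
    case False
    then show ?thesis using that assms(1) by (auto simp: set_eq_iff Suc_le_eq)
  qed
  then have arcs: "\<And>a. a < i \<Longrightarrow> (a, i) \<in> R \<longleftrightarrow> (a, i) \<in> R'"
    "\<And>a. a < i \<Longrightarrow> (i, a) \<in> R \<longleftrightarrow> (i, a) \<in> R'" "(i, i) \<in> R \<longleftrightarrow> (i, i) \<in> R'"
    by simp_all
  have "R \<inter> {1..<i} \<times> {1..<i} = R' \<inter> {1..<i} \<times> {1..<i}" using eq by auto
  then have "cycle_peak_with Q i R = cycle_peak_with Q i R'" for Q
    unfolding cycle_peak_with_def by (simp add: arcs cong: conj_cong)
  then show ?thesis unfolding arc_weight_def by (simp add: arcs cong: conj_cong)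
qed

lemma arc_weight_extensions:
  assumes R: "R \<in> partial_perms n"
  defines "m \<equiv> Suc n"
  shows "arc_weight Q Q' t l y w m R = 1"
    and "arc_weight Q Q' t l y w m (insert (m, m) R) = w"
    and "s \<in> {1..n} \<Longrightarrow> arc_weight Q Q' t l y w m (insert (s, m) R) = t"
    and "v \<in> {1..n} \<Longrightarrow> arc_weight Q Q' t l y w m (insert (m, v) R) = 1"
    and "s \<in> {1..n} \<Longrightarrow> v \<in> {1..n} \<Longrightarrow>
      arc_weight Q Q' t l y w m (insert (s, m) (insert (m, v) R)) =
        t * ((if Q n R s v then l else 1) * (if Q' n R s v then y else 1))"
proof -
  have m: "(a, m) \<notin> R" "(m, a) \<notin> R" for a
    using R by (auto simp: partial_perms_def m_def)
  have RR: "R \<inter> {1..<m} \<times> {1..<m} = R"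
    using R by (auto simp: partial_perms_def m_def)
  show "arc_weight Q Q' t l y w m R = 1"
    by (simp add: arc_weight_def cycle_peak_with_def m)
  show "arc_weight Q Q' t l y w m (insert (m, m) R) = w"
    by (simp add: arc_weight_def cycle_peak_with_def m)
  show "arc_weight Q Q' t l y w m (insert (s, m) R) = t" if "s \<in> {1..n}"
    using that m by (auto simp: arc_weight_def cycle_peak_with_def m_def)
  show "arc_weight Q Q' t l y w m (insert (m, v) R) = 1" if "v \<in> {1..n}"
    using that m by (auto simp: arc_weight_def cycle_peak_with_def m_def)
  show "arc_weight Q Q' t l y w m (insert (s, m) (insert (m, v) R)) =
        t * ((if Q n R s v then l else 1) * (if Q' n R s v then y else 1))"
    if "s \<in> {1..n}" "v \<in> {1..n}"
  proof -
    let ?R = "insert (s, m) (insert (m, v) R)"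
    have lt: "s < m" "v < m" using that by (auto simp: m_def)
    have in1: "\<And>a. (a, m) \<in> ?R \<longleftrightarrow> a = s" and in2: "\<And>a. (m, a) \<in> ?R \<longleftrightarrow> a = v"
      using m lt by auto
    have "?R \<inter> {1..<m} \<times> {1..<m} = R" using RR by auto
    then have "cycle_peak_with Q m ?R \<longleftrightarrow> Q n R s v" for Q
      unfolding cycle_peak_with_def in1 in2 using lt by (auto simp: m_def)
    then show ?thesis unfolding arc_weight_def in1 using lt by auto
  qed
qed

text \<open>The weighted number of partial permutations with \<open>h\<close> free sources satisfies
  the path recurrence: an isolated element weighs 1, the insertions that keep \<open>h\<close> add
  up to \<open>w + h (t + 1)\<close>, and the peaks give \<open>\<beta>\<close> by the hypothesis.
  Leaving \<open>Q\<close> and \<open>Q'\<close> open lets one proof serve three markings.\<close>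

lemma sum_arc_weights:
  fixes t l y w :: "'a::comm_ring_1"
  assumes peaks: "\<And>n h R. R \<in> partial_perms n \<Longrightarrow> card R + Suc h = n \<Longrightarrow>
    (\<Sum>s \<in> {1..n} - Domain R. \<Sum>v \<in> {1..n} - Range R.
       (if Q n R s v then l else 1) * (if Q' n R s v then y else 1))
      = (l + of_nat h) * (y + of_nat h)"
  shows "(\<Sum>R | R \<in> partial_perms n \<and> card R = n. \<Prod>i\<in>{1..n}. arc_weight Q Q' t l y w i R)
    = A n t l y w"
proof -
  let ?q = "arc_weight Q Q' t l y w"
  define W where "W n R = (\<Prod>i\<in>{1..n}. ?q i R)" for n R
  define T where "T n h = (\<Sum>R \<in> partial_perms n. if card R + h = n then W n R else 0)" for n h
  have W_Suc: "W (Suc n) R' = W n R * ?q (Suc n) R'"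
    if R: "R \<in> partial_perms n" "R' \<in> extensions n R" for n R R'
  proof -
    have R': "R' \<in> partial_perms (Suc n)" "R' \<inter> {1..n} \<times> {1..n} = R"
      using that extensions_iff by blast+
    have "?q i R' = ?q i R" if "i \<in> {1..n}" for i
    proof (rule arc_weight_cong)
      have "R' \<inter> {1..i} \<times> {1..i} = R' \<inter> {1..n} \<times> {1..n} \<inter> {1..i} \<times> {1..i}"
        using that by auto
      then show "R' \<inter> {1..i} \<times> {1..i} = R \<inter> {1..i} \<times> {1..i}" using R'(2) by simp
    qed (use R R'(1) in \<open>auto simp: partial_perms_def\<close>)
    then show ?thesis by (simp add: W_def)
  qed
  \<comment> \<open>The three terms come from \<open>R\<close> with \<open>h - 1\<close>,
    \<open>h\<close> and \<open>h + 1\<close> free sources. Writing the conditions as sums avoids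
    truncated subtraction, and \<open>h = 0\<close> needs no case of its own.\<close>
  have T_Suc: "T (Suc n) h = (\<Sum>R \<in> partial_perms n.
      (if card R + h = Suc n then W n R else 0)
      + A_gamma t w h * (if card R + h = n then W n R else 0)
      + A_beta t l y (Suc h) * (if card R + Suc h = n then W n R else 0))" for n h
  proof -
    let ?F = "\<lambda>R'. if card R' + h = Suc n then W (Suc n) R' else 0"
    have inner: "sum ?F (extensions n R) =
      (if card R + h = Suc n then W n R else 0)
      + A_gamma t w h * (if card R + h = n then W n R else 0)
      + A_beta t l y (Suc h) * (if card R + Suc h = n then W n R else 0)"
      if R: "R \<in> partial_perms n" for R
    proof -
      let ?S = "{1..n} - Domain R" and ?V = "{1..n} - Range R"
      have fin: "finite R" using R by (rule partial_perms_finite)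
      have m: "(a, Suc n) \<notin> R" "(Suc n, a) \<notin> R" for a
        using R by (auto simp: partial_perms_def)
      note W = W_Suc[OF R, unfolded extensions_def]
      note q = arc_weight_extensions[OF R, where Q = Q and Q' = Q' and t = t and l = l and y = y and w = w]
      have "?F R = (if card R + h = Suc n then W n R else 0)"
        using W[of R] q(1) by simp
      moreover have "?F (insert (Suc n, Suc n) R) = w * (if card R + h = n then W n R else 0)"
        using W[of "insert (Suc n, Suc n) R"] q(2) fin m by simp
      moreover have "(\<Sum>s\<in>?S. ?F (insert (s, Suc n) R))
          = of_nat h * t * (if card R + h = n then W n R else 0)"
      proof -
        have "?F (insert (s, Suc n) R) = t * (if card R + h = n then W n R else 0)" if "s \<in> ?S" for s
          using W[of "insert (s, Suc n) R"] q(3)[of s] fin m that by simp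
        moreover have "card ?S = h" if "card R + h = n"
          using card_free_sources[OF R] that by simp
        ultimately show ?thesis by simp
      qed
      moreover have "(\<Sum>v\<in>?V. ?F (insert (Suc n, v) R))
          = of_nat h * (if card R + h = n then W n R else 0)"
      proof -
        have "?F (insert (Suc n, v) R) = (if card R + h = n then W n R else 0)" if "v \<in> ?V" for v
          using W[of "insert (Suc n, v) R"] q(4)[of v] fin m that by simp
        moreover have "card ?V = h" if "card R + h = n"
          using card_free_targets[OF R] that by simp
        ultimately show ?thesis by simp
      qed
      moreover have "(\<Sum>s\<in>?S. \<Sum>v\<in>?V. ?F (insert (s, Suc n) (insert (Suc n, v) R)))
          = A_beta t l y (Suc h) * (if card R + Suc h = n then W n R else 0)"
      proof -
        have "?F (insert (s, Suc n) (insert (Suc n, v) R)) =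
            t * (if card R + Suc h = n then W n R else 0)
            * ((if Q n R s v then l else 1) * (if Q' n R s v then y else 1))"
          if "s \<in> ?S" "v \<in> ?V" for s v
        proof -
          have "insert (s, Suc n) (insert (Suc n, v) R) \<in> extensions n R"
            unfolding extensions_def using that by auto
          then show ?thesis
            using W_Suc[OF R, of "insert (s, Suc n) (insert (Suc n, v) R)"] q(5)[of s v] fin m that
            by (auto simp: mult_ac)
        qed
        then have "(\<Sum>s\<in>?S. \<Sum>v\<in>?V. ?F (insert (s, Suc n) (insert (Suc n, v) R))) =
          (\<Sum>s\<in>?S. \<Sum>v\<in>?V. t * (if card R + Suc h = n then W n R else 0)
            * ((if Q n R s v then l else 1) * (if Q' n R s v then y else 1)))"
          by (intro sum.cong refl) blast
        also have "\<dots> = t * (if card R + Suc h = n then W n R else 0) *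
          (\<Sum>s\<in>?S. \<Sum>v\<in>?V. (if Q n R s v then l else 1) * (if Q' n R s v then y else 1))"
          by (simp only: sum_distrib_left)
        finally show ?thesis
          using peaks[OF R, of h] by (simp add: A_beta_def mult_ac)
      qed
      ultimately show ?thesis
        unfolding sum_extensions[OF R] by (simp add: A_gamma_def algebra_simps)
    qed
    have "T (Suc n) h = (\<Sum>R \<in> partial_perms n.
        \<Sum>R' | R' \<in> partial_perms (Suc n) \<and> R' \<inter> {1..n} \<times> {1..n} = R. ?F R')"
      unfolding T_def by (rule sum.group[symmetric])
        (auto simp: partial_perms_def single_valued_def)
    also have "\<dots> = (\<Sum>R \<in> partial_perms n. sum ?F (extensions n R))"
    proof (rule sum.cong[OF refl])
      fix R assume "R \<in> partial_perms n"
      then have "{R'. R' \<in> partial_perms (Suc n) \<and> R' \<inter> {1..n} \<times> {1..n} = R} = extensions n R"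
        using extensions_iff by blast
      then show "(\<Sum>R' | R' \<in> partial_perms (Suc n) \<and> R' \<inter> {1..n} \<times> {1..n} = R. ?F R')
          = sum ?F (extensions n R)" by simp
    qed
    finally show ?thesis using inner by simp
  qed
  have "A n t l y w = T n 0"
    unfolding A_def
  proof (rule jfrac_nth_eq_path_table)
    have "partial_perms 0 = {{}}" by (auto simp: partial_perms_def)
    then show "T 0 h = (if h = 0 then 1 else 0)" for h by (simp add: T_def W_def)
    show "T (Suc n) 0 = A_gamma t w 0 * T n 0 + A_beta t l y 1 * T n 1" for n
    proof -
      \<comment> \<open>No step up ends at height 0: a partial permutation of \<open>n\<close>
        elements has at most \<open>n\<close> arcs.\<close>
      have "(\<Sum>R \<in> partial_perms n. if card R = Suc n then W n R else 0) = 0"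
        using card_partial_perm_le by (intro sum.neutral) fastforce
      then show ?thesis
        unfolding T_Suc unfolding T_def by (simp add: sum.distrib sum_distrib_left)
    qed
    show "T (Suc n) (Suc h) = T n h + A_gamma t w (Suc h) * T n (Suc h)
      + A_beta t l y (Suc (Suc h)) * T n (Suc (Suc h))" for n h
      unfolding T_Suc unfolding T_def by (simp add: sum.distrib sum_distrib_left)
  qed
  moreover have "T n 0 = (\<Sum>R | R \<in> partial_perms n \<and> card R = n. W n R)"
    unfolding T_def by (simp add: sum.inter_filter)
  ultimately show ?thesis by (simp add: W_def)
qed

section \<open>Total peak weight for the three markings\<close>

text \<open>One condition concerns only the source and the other only the target, so the double sum
  factors.\<close>

lemma sum_peaks_last_source_first_target:
  fixes l y :: "'a::comm_ring_1"
  assumes R: "R \<in> partial_perms n" "card R + Suc h = n"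
  shows "(\<Sum>s \<in> {1..n} - Domain R. \<Sum>v \<in> {1..n} - Range R.
       (if last_source n R s v then l else 1) * (if first_target n R s v then y else 1))
      = (l + of_nat h) * (y + of_nat h)"
proof -
  let ?S = "{1..n} - Domain R" and ?V = "{1..n} - Range R"
  have c: "card ?S = Suc h" "card ?V = Suc h"
    using card_free_sources[OF R(1)] card_free_targets[OF R(1)] R(2) by auto
  have ne: "?S \<noteq> {}" "?V \<noteq> {}" using c by (metis card.empty nat.distinct(1))+
  \<comment> \<open>The value 0 on the right is a placeholder for the end on which the condition
    does not depend.\<close>
  have "(\<Sum>s\<in>?S. \<Sum>v\<in>?V. (if last_source n R s v then l else 1) * (if first_target n R s v then y else 1))
    = (\<Sum>s\<in>?S. if last_source n R s 0 then l else 1) * (\<Sum>v\<in>?V. if first_target n R 0 v then y else 1)"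
    unfolding sum_product by (simp add: last_source_def first_target_def)
  also have "\<dots> = (l + of_nat h) * (y + of_nat h)"
    using sum_one_marked[OF _ ex1_last_source[OF ne(1)] c(1), where x = l]
      sum_one_marked[OF _ ex1_first_target[OF ne(2)] c(2), where x = y] by simp
  finally show ?thesis .
qed

text \<open>\<open>joined\<close> couples source and target, but every free target has exactly one
  joined source. The inner sum over sources is therefore the same for all targets and can be pulled
  out.\<close>

lemma sum_peaks_joined_first_target:
  fixes l y :: "'a::comm_ring_1"
  assumes R: "R \<in> partial_perms n" "card R + Suc h = n"
  shows "(\<Sum>s \<in> {1..n} - Domain R. \<Sum>v \<in> {1..n} - Range R.
       (if joined n R s v then l else 1) * (if first_target n R s v then y else 1))
      = (l + of_nat h) * (y + of_nat h)"
proof -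
  let ?S = "{1..n} - Domain R" and ?V = "{1..n} - Range R"
  have c: "card ?S = Suc h" "card ?V = Suc h"
    using card_free_sources[OF R(1)] card_free_targets[OF R(1)] R(2) by auto
  have ne: "?V \<noteq> {}" using c by (metis card.empty nat.distinct(1))
  have "(\<Sum>s\<in>?S. \<Sum>v\<in>?V. (if joined n R s v then l else 1) * (if first_target n R s v then y else 1))
    = (\<Sum>v\<in>?V. (if first_target n R 0 v then y else 1) * (\<Sum>s\<in>?S. if joined n R s v then l else 1))"
    by (subst sum.swap) (simp only: first_target_def sum_distrib_left mult.commute)
  also have "\<dots> = (\<Sum>v\<in>?V. (if first_target n R 0 v then y else 1) * (l + of_nat h))"
    using sum_one_marked[OF _ ex1_joined_source[OF R(1)] c(1), where x = l] by (intro sum.cong refl) simp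
  also have "\<dots> = (\<Sum>v\<in>?V. if first_target n R 0 v then y else 1) * (l + of_nat h)"
    by (simp only: sum_distrib_right)
  also have "\<dots> = (l + of_nat h) * (y + of_nat h)"
    using sum_one_marked[OF _ ex1_first_target[OF ne] c(2), where x = y] by (simp add: mult.commute)
  finally show ?thesis .
qed

text \<open>Here the inner sum runs over targets: every free source has exactly one joined
  target.\<close>

lemma sum_peaks_joined_last_source:
  fixes l y :: "'a::comm_ring_1"
  assumes R: "R \<in> partial_perms n" "card R + Suc h = n"
  shows "(\<Sum>s \<in> {1..n} - Domain R. \<Sum>v \<in> {1..n} - Range R.
       (if joined n R s v then l else 1) * (if last_source n R s v then y else 1))
      = (l + of_nat h) * (y + of_nat h)"
proof -
  let ?S = "{1..n} - Domain R" and ?V = "{1..n} - Range R"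
  have c: "card ?S = Suc h" "card ?V = Suc h"
    using card_free_sources[OF R(1)] card_free_targets[OF R(1)] R(2) by auto
  have ne: "?S \<noteq> {}" using c by (metis card.empty nat.distinct(1))
  have "(\<Sum>s\<in>?S. \<Sum>v\<in>?V. (if joined n R s v then l else 1) * (if last_source n R s v then y else 1))
    = (\<Sum>s\<in>?S. (if last_source n R s 0 then y else 1) * (\<Sum>v\<in>?V. if joined n R s v then l else 1))"
    by (simp only: last_source_def sum_distrib_left mult.commute)
  also have "\<dots> = (\<Sum>s\<in>?S. (if last_source n R s 0 then y else 1) * (l + of_nat h))"
    using sum_one_marked[OF _ ex1_joined_target[OF R(1)] c(2), where x = l] by (intro sum.cong refl) simp
  also have "\<dots> = (\<Sum>s\<in>?S. if last_source n R s 0 then y else 1) * (l + of_nat h)"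
    by (simp only: sum_distrib_right)
  also have "\<dots> = (l + of_nat h) * (y + of_nat h)"
    using sum_one_marked[OF _ ex1_last_source[OF ne] c(1), where x = y] by (simp add: mult.commute)
  finally show ?thesis .
qed

section \<open>Pure and copure arcs of increasing matchings\<close>

context linorder
begin

text \<open>An arbitrary linear order is used so that the count of pure arcs can be applied again to
  the reversed order, where it counts copure arcs.\<close>

definition matchings :: "'a set \<Rightarrow> 'a set \<Rightarrow> ('a \<times> 'a) set set" where
  "matchings S T = {U. Domain U = S \<and> Range U = T \<and> single_valued U \<and> single_valued (U\<inverse>)
     \<and> (\<forall>(a, b) \<in> U. a < b)}"

definition pure_arcs :: "('a \<times> 'a) set \<Rightarrow> ('a \<times> 'a) set" where
  "pure_arcs U = {(a, b) \<in> U. \<forall>(c, d) \<in> U. c < a \<longrightarrow> \<not> (a \<le> d \<and> d \<le> b)}"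

lemma matchings_subset: "U \<in> matchings S T \<Longrightarrow> U \<subseteq> S \<times> T"
  by (auto simp: matchings_def)

lemma matchings_insert_max:
  assumes max: "\<And>c. c \<in> S \<Longrightarrow> c < a"
  shows "matchings (insert a S) T = (\<Union>b \<in> {b \<in> T. a < b}. insert (a, b) ` matchings S (T - {b}))"
    (is "?L = ?R")
proof
  show "?L \<subseteq> ?R"
  proof
    fix U assume U: "U \<in> ?L"
    then obtain b where b: "(a, b) \<in> U" by (auto simp: matchings_def)
    have inj: "\<And>x y z. (x, y) \<in> U \<Longrightarrow> (x, z) \<in> U \<Longrightarrow> y = z" "\<And>x y z. (y, x) \<in> U \<Longrightarrow> (z, x) \<in> U \<Longrightarrow> y = z"
      and dom: "Domain U = insert a S" and ran: "Range U = T" and lt: "\<And>x y. (x, y) \<in> U \<Longrightarrow> x < y"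
      using U by (auto simp: matchings_def single_valued_def)
    let ?U = "U - {(a, b)}"
    have aA: "a \<notin> S" using max by blast
    have "Domain ?U = S"
    proof (intro equalityI subsetI)
      fix x assume "x \<in> Domain ?U"
      then obtain z where z: "(x, z) \<in> U" "(x, z) \<noteq> (a, b)" by auto
      then have "x \<noteq> a" using inj(1)[OF b] by auto
      then show "x \<in> S" using z dom by auto
    next
      fix x assume "x \<in> S"
      then show "x \<in> Domain ?U" using dom aA by blast
    qed
    moreover have "Range ?U = T - {b}"
    proof (intro equalityI subsetI)
      fix x assume "x \<in> Range ?U"
      then obtain z where z: "(z, x) \<in> U" "(z, x) \<noteq> (a, b)" by auto
      then have "x \<noteq> b" using inj(2)[OF b] by auto
      then show "x \<in> T - {b}" using z ran by auto
    next
      fix x assume "x \<in> T - {b}"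
      then show "x \<in> Range ?U" using ran by blast
    qed
    moreover have "single_valued ?U" "single_valued (?U\<inverse>)"
      using inj unfolding single_valued_def by blast+
    ultimately have "?U \<in> matchings S (T - {b})"
      using lt by (auto simp: matchings_def)
    moreover have "U = insert (a, b) ?U" using b by auto
    ultimately have "U \<in> insert (a, b) ` matchings S (T - {b})" by (rule rev_image_eqI)
    moreover have "b \<in> {b \<in> T. a < b}" using b lt ran by auto
    ultimately show "U \<in> ?R" by (intro UN_I)
  qed
  show "?R \<subseteq> ?L"
  proof clarify
    fix b U assume b: "b \<in> T" "a < b" and U: "U \<in> matchings S (T - {b})"
    have "a \<notin> Domain U" "b \<notin> Range U" using U max by (auto simp: matchings_def)
    then have "single_valued (insert (a, b) U)" "single_valued ((insert (a, b) U)\<inverse>)"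
      using U unfolding matchings_def single_valued_def by blast+
    then show "insert (a, b) U \<in> ?L"
      using U b by (auto simp: matchings_def)
  qed
qed

text \<open>
  Remove the largest source \<open>a\<close>: any target \<open>b > a\<close> is admissible, the remaining sum does not depend on
  \<open>b\<close>, and \<open>a\<close> is pure iff \<open>b\<close> is the least target that is not below \<open>a\<close>.
\<close>

lemma sum_matchings_pure_arcs:
  fixes x :: "'b::comm_ring_1"
  assumes "finite S" "finite T" "card S = card T"
    and "\<And>a. a \<in> S \<Longrightarrow> card {c \<in> S. a < c} < card {b \<in> T. a < b}"
  shows "(\<Sum>U \<in> matchings S T. x ^ card (pure_arcs U)) =
    (\<Prod>a\<in>S. of_nat (card {b \<in> T. a < b} - card {c \<in> S. a < c}) + (if a \<in> T then 0 else x - 1))"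
  using assms
proof (induction S arbitrary: T rule: finite_linorder_max_induct)
  case empty
  then have "matchings {} T = {{}}" by (auto simp: matchings_def)
  then show ?case by (simp add: pure_arcs_def)
next
  case (insert a S)
  let ?T = "{b \<in> T. a < b}"
  let ?g = "\<lambda>S T a. of_nat (card {b \<in> T. a < b} - card {c \<in> S. a < c}) + (if a \<in> T then 0 else x - 1)"
  \<comment> \<open>All other targets are hit from sources below \<open>a\<close>, so
    \<open>(a, b)\<close> is pure iff no other target lies in \<open>[a, b]\<close>. If
    \<open>a\<close> is itself a target, this fails for every \<open>b > a\<close>.\<close>
  define mk where "mk b \<longleftrightarrow> (\<forall>d \<in> T. a \<le> d \<and> d \<le> b \<longrightarrow> d = b)" for b
  have aA: "a \<notin> S" using insert.hyps by blast
  have fin: "finite (matchings S (T - {b}))" for b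
    by (rule finite_subset[of _ "Pow (S \<times> (T - {b}))"])
      (use insert.hyps insert.prems in \<open>auto dest!: matchings_subset\<close>)
  have finU: "finite U" if "U \<in> matchings S (T - {b})" for U b
    by (rule finite_subset[OF matchings_subset[OF that]]) (use insert.hyps insert.prems in auto)
  have inner: "(\<Sum>U \<in> insert (a, b) ` matchings S (T - {b}). x ^ card (pure_arcs U)) =
      (if mk b then x else 1) * (\<Prod>c\<in>S. ?g (insert a S) T c)"
    if b: "b \<in> ?T" for b
  proof -
    have new: "(a, b) \<notin> U" if "U \<in> matchings S (T - {b})" for U
      using that aA by (auto simp: matchings_def)
    have inj: "inj_on (insert (a, b)) (matchings S (T - {b}))"
      using new by (auto simp: inj_on_def insert_ident)
    have pure: "card (pure_arcs (insert (a, b) U)) =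
        (if mk b then 1 else 0) + card (pure_arcs U)"
      if U: "U \<in> matchings S (T - {b})" for U
    proof -
      have dom: "\<And>c d. (c, d) \<in> U \<Longrightarrow> c < a \<and> d \<in> T - {b}"
        using matchings_subset[OF U] insert.hyps(2) by blast
      have ran: "\<And>d. d \<in> T \<Longrightarrow> d \<noteq> b \<Longrightarrow> \<exists>c. (c, d) \<in> U"
        using U by (auto simp: matchings_def)
      have "(\<forall>(c, d) \<in> insert (a, b) U. c < a \<longrightarrow> \<not> (a \<le> d \<and> d \<le> b)) \<longleftrightarrow>
          mk b"
        unfolding mk_def using dom ran by fast
      \<comment> \<open>The new arc has the largest source and so cannot spoil the purity of an old
        arc.\<close>
      moreover have "(\<forall>(c, d) \<in> insert (a, b) U. c < a' \<longrightarrow> \<not> (a' \<le> d \<and> d \<le> b')) \<longleftrightarrow>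
          (\<forall>(c, d) \<in> U. c < a' \<longrightarrow> \<not> (a' \<le> d \<and> d \<le> b'))" if "(a', b') \<in> U" for a' b'
        using dom[OF that] by auto
      ultimately have "pure_arcs (insert (a, b) U) =
          (if mk b then {(a, b)} else {}) \<union> pure_arcs U"
        unfolding pure_arcs_def by (auto split: if_splits)
      moreover have "(a, b) \<notin> pure_arcs U" "finite (pure_arcs U)"
        using new[OF U] finU[OF U] by (auto simp: pure_arcs_def intro: finite_subset)
      ultimately show ?thesis by simp
    qed
    \<comment> \<open>As \<open>c < a < b\<close>, removing \<open>a\<close> and \<open>b\<close>
      lowers both counts above \<open>c\<close> by one: the strict inequality and the local factor
      at \<open>c\<close> survive.\<close>
    have hall: "card {d \<in> T - {b}. c < d} = card {d \<in> T. c < d} - 1 \<and>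
        card {c' \<in> insert a S. c < c'} = Suc (card {c' \<in> S. c < c'}) \<and> 1 \<le> card {d \<in> T. c < d}"
      if "c \<in> S" for c
    proof -
      have "c < a" using that insert.hyps by blast
      then have "{c' \<in> insert a S. c < c'} = insert a {c' \<in> S. c < c'}" by auto
      moreover have "{d \<in> T - {b}. c < d} = {d \<in> T. c < d} - {b}" "b \<in> {d \<in> T. c < d}"
        using b \<open>c < a\<close> by auto
      ultimately show ?thesis
        using insert.hyps insert.prems aA by (auto simp: Suc_le_eq card_gt_0_iff)
    qed
    have "(\<Sum>U \<in> matchings S (T - {b}). x ^ card (pure_arcs U)) = (\<Prod>c\<in>S. ?g S (T - {b}) c)"
    proof (rule insert.IH)
      show "card S = card (T - {b})" using insert b aA by auto
      show "card {c \<in> S. c' < c} < card {d \<in> T - {b}. c' < d}" if "c' \<in> S" for c'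
        using insert.prems(3)[OF insertI2[OF that]] hall[OF that] by linarith
    qed (use insert.prems in auto)
    also have "\<dots> = (\<Prod>c\<in>S. ?g (insert a S) T c)"
    proof (rule prod.cong[OF refl])
      fix c assume c: "c \<in> S"
      have "c \<noteq> b" using c b insert.hyps by auto
      moreover have "card {d \<in> T - {b}. c < d} - card {c' \<in> S. c < c'} =
          card {d \<in> T. c < d} - card {c' \<in> insert a S. c < c'}"
        using hall[OF c] by linarith
      ultimately show "?g S (T - {b}) c = ?g (insert a S) T c" by simp
    qed
    finally show ?thesis
      by (simp add: sum.reindex[OF inj] pure power_add sum_distrib_left[symmetric])
  qed
  have marked: "(\<Sum>b\<in>?T. if mk b then x else 1) = ?g (insert a S) T a"
  proof -
    have none: "{c \<in> insert a S. a < c} = {}" using insert.hyps by auto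
    have finB: "finite ?T" using insert.prems by auto
    have "card {c \<in> insert a S. a < c} < card ?T" using insert.prems by blast
    then have "0 < card ?T" by linarith
    then have ne: "?T \<noteq> {}" by (intro notI) simp
    show ?thesis
    proof (cases "a \<in> T")
      case True
      then have "(\<Sum>b\<in>?T. if mk b then x else 1) = (\<Sum>b\<in>?T. 1)"
        by (intro sum.cong) (auto simp: mk_def)
      then show ?thesis using True unfolding none by simp
    next
      case False
      have m: "Min ?T \<in> ?T" using finB ne by (rule Min_in)
      have le: "Min ?T \<le> d" if "d \<in> ?T" for d using finB that by (rule Min_le)
      have iff: "mk b \<longleftrightarrow> b = Min ?T" if "b \<in> ?T" for b
      proof
        assume "mk b"
        then show "b = Min ?T" unfolding mk_def using m le[OF that] by auto
      next
        assume eq: "b = Min ?T"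
        show "mk b"
          unfolding mk_def
        proof (intro ballI impI)
          fix d assume "d \<in> T" "a \<le> d \<and> d \<le> b"
          moreover from this have "d \<in> ?T" using False by (auto simp: order.order_iff_strict)
          ultimately show "d = b" using le[of d] eq by (simp add: order.antisym)
        qed
      qed
      have "(\<Sum>b\<in>?T. if mk b then x else 1) =
          (\<Sum>b\<in>?T. if b = Min ?T then x else 1)"
        by (intro sum.cong refl) (simp only: iff)
      also have "\<dots> = x + (\<Sum>b\<in>?T - {Min ?T}. if b = Min ?T then x else 1)"
        using finB m by (subst sum.remove[of _ "Min ?T"]) auto
      also have "(\<Sum>b\<in>?T - {Min ?T}. if b = Min ?T then x else 1) = (\<Sum>b\<in>?T - {Min ?T}. 1)"
        by (intro sum.cong) auto
      also have "x + \<dots> = x + (of_nat (card ?T) - 1)"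
        using m finB ne by (simp add: card_Diff_singleton of_nat_diff Suc_le_eq card_gt_0_iff)
      finally show ?thesis using False unfolding none by simp
    qed
  qed
  have decomp: "matchings (insert a S) T = (\<Union>b \<in> ?T. insert (a, b) ` matchings S (T - {b}))"
    by (rule matchings_insert_max) (use insert.hyps in blast)
  have "(\<Sum>U \<in> matchings (insert a S) T. x ^ card (pure_arcs U)) =
      (\<Sum>b \<in> ?T. \<Sum>U \<in> insert (a, b) ` matchings S (T - {b}). x ^ card (pure_arcs U))"
    unfolding decomp
  proof (rule sum.UNION_disjoint)
    show "\<forall>i\<in>?T. \<forall>j\<in>?T. i \<noteq> j \<longrightarrow>
        insert (a, i) ` matchings S (T - {i}) \<inter> insert (a, j) ` matchings S (T - {j}) = {}"
    proof (intro ballI impI)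
      fix i j :: 'a assume "i \<noteq> j"
      have "(a, i) \<notin> V" if "V \<in> insert (a, j) ` matchings S (T - {j})" for V
        using that \<open>i \<noteq> j\<close> aA matchings_subset by blast
      then show "insert (a, i) ` matchings S (T - {i}) \<inter> insert (a, j) ` matchings S (T - {j}) = {}"
        by blast
    qed
  qed (use insert.prems fin in auto)
  also have "\<dots> = (\<Sum>b\<in>?T. (if mk b then x else 1)
      * (\<Prod>c\<in>S. ?g (insert a S) T c))"
    by (rule sum.cong[OF refl inner])
  also have "\<dots> = ?g (insert a S) T a * (\<Prod>c\<in>S. ?g (insert a S) T c)"
    unfolding sum_distrib_right[symmetric] marked ..
  finally show ?case using insert.hyps aA by simp
qed

end

section \<open>Copure arcs and heights of the lattice path\<close>

definition copure_arcs :: "(nat \<times> nat) set \<Rightarrow> (nat \<times> nat) set" where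
  "copure_arcs U = {(a, b) \<in> U. \<forall>(c, d) \<in> U. b < d \<longrightarrow> \<not> (a \<le> c \<and> c \<le> b)}"

text \<open>Sending each target to its source is injective. The shift by one holds since a source is
  strictly below its target.\<close>

lemma matchings_heights:
  fixes S T :: "nat set"
  assumes U: "U \<in> matchings S T" and "finite S"
  shows "card {b \<in> T. b < Suc k} \<le> card {a \<in> S. a < k}"
proof -
  let ?f = "\<lambda>b. THE a. (a, b) \<in> U"
  have f: "?f b = a" if "(a, b) \<in> U" for a b
    using that U by (auto simp: matchings_def single_valued_def)
  have arc: "(?f b, b) \<in> U" if "b \<in> T" for b
  proof -
    have "b \<in> Range U" using U that by (simp add: matchings_def)
    then obtain a where "(a, b) \<in> U" by (elim RangeE)
    then show ?thesis using f by simp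
  qed
  show ?thesis
  proof (rule card_inj_on_le)
    show "inj_on ?f {b \<in> T. b < Suc k}"
    proof (rule inj_onI)
      fix b b' assume "b \<in> {b \<in> T. b < Suc k}" "b' \<in> {b \<in> T. b < Suc k}" "?f b = ?f b'"
      then have "(?f b, b) \<in> U" "(?f b, b') \<in> U" using arc[of b] arc[of b'] by auto
      then show "b = b'" using U unfolding matchings_def single_valued_def by blast
    qed
    show "?f ` {b \<in> T. b < Suc k} \<subseteq> {a \<in> S. a < k}"
    proof clarify
      fix b assume b: "b \<in> T" "b < Suc k"
      have "?f b < b" "?f b \<in> S" using arc[OF b(1)] U unfolding matchings_def by blast+
      then show "?f b \<in> S \<and> ?f b < k" using b by simp
    qed
    show "finite {a \<in> S. a < k}" using assms by simp
  qed
qed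

text \<open>Reading the numbers in order, step up at a source and down at a target;
  \<open>s k - t k\<close> is the height before step \<open>k\<close>. The products of local factors
  over up steps and over down steps differ by the rising factorial of the current height, which is 1
  once the path is back at 0. A number in both sets leaves the height unchanged and contributes
  equal factors.\<close>

lemma prod_heights:
  fixes x :: "'a::comm_ring_1"
  assumes "finite S" "finite T"
    and h: "\<And>k. card {b \<in> T. b < Suc k} \<le> card {a \<in> S. a < k}"
  defines "s \<equiv> \<lambda>k. card {a \<in> S. a < k}" and "t \<equiv> \<lambda>k. card {b \<in> T. b < k}"
  shows "(\<Prod>a | a \<in> S \<and> a < k. of_nat (s (Suc a) - t (Suc a)) + (if a \<in> T then 0 else x - 1)) =
    (\<Prod>b | b \<in> T \<and> b < k. of_nat (s b - t b) + (if b \<in> S then 0 else x - 1))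
      * (\<Prod>j<s k - t k. x + of_nat j)"
proof (induction k)
  case 0
  show ?case by (simp add: s_def t_def)
next
  case (Suc k)
  have ins: "{a \<in> X. a < Suc k} = (if k \<in> X then insert k {a \<in> X. a < k} else {a \<in> X. a < k})"
    for X :: "nat set" by (auto simp: less_Suc_eq)
  have s: "s (Suc k) = (if k \<in> S then Suc (s k) else s k)"
    unfolding s_def ins using assms(1) by simp
  have t: "t (Suc k) = (if k \<in> T then Suc (t k) else t k)"
    unfolding t_def ins using assms(2) by simp
  have le: "t (Suc k) \<le> s k" using h[of k] by (simp add: s_def t_def)
  then have le': "t k \<le> s k" using t by (auto split: if_splits)
  consider "k \<in> S" "k \<in> T" | "k \<in> S" "k \<notin> T" | "k \<notin> S" "k \<in> T" | "k \<notin> S" "k \<notin> T" by blast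
  then show ?case
  proof cases
    case 1
    then show ?thesis
      using Suc assms(1,2) unfolding ins by (simp add: s t algebra_simps)
  next
    case 2
    \<comment> \<open>At an up step both sides gain the factor \<open>x\<close> plus the current
      height.\<close>
    moreover have "Suc (s k) - t k = Suc (s k - t k)" using le' by simp
    ultimately show ?thesis
      using Suc assms(1,2) unfolding ins by (simp add: s t algebra_simps)
  next
    case 3
    \<comment> \<open>At a down step the height is positive, and the top factor \<open>x + d\<close>
      of the rising factorial moves into the product over targets.\<close>
    then obtain d where d: "s k - t k = Suc d" using le t by (cases "s k - t k") auto
    then have "s k - Suc (t k) = d" by simp
    then show ?thesis
      using 3 d Suc assms(1,2) unfolding ins by (simp add: s t algebra_simps)
  next
    case 4
    then show ?thesis
      using Suc unfolding ins by (simp add: s t)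
  qed
qed

text \<open>Copure arcs are the pure arcs of the converse relation with respect to the opposite order.\<close>

lemma dual_matchings: "linorder.matchings (>) T S = converse ` matchings S (T :: nat set)"
proof -
  have iff: "V \<in> linorder.matchings (>) T S \<longleftrightarrow> V\<inverse> \<in> matchings S T" for V
    unfolding linorder.matchings_def[OF dual_linorder] matchings_def by auto
  show ?thesis
  proof (intro equalityI subsetI)
    fix V assume "V \<in> linorder.matchings (>) T S"
    then show "V \<in> converse ` matchings S T"
      unfolding iff by (rule rev_image_eqI) (rule converse_converse[symmetric])
  next
    fix V assume "V \<in> converse ` matchings S T"
    then obtain U where "U \<in> matchings S T" "V = U\<inverse>" by (elim imageE)
    then show "V \<in> linorder.matchings (>) T S" unfolding iff by (simp only: converse_converse)
  qed
qed

lemma dual_pure_arcs: "linorder.pure_arcs (\<ge>) (>) (U\<inverse>) = (copure_arcs U)\<inverse>"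
  unfolding linorder.pure_arcs_def[OF dual_linorder] copure_arcs_def by auto

text \<open>Both sums are products of local factors, the copure one by reversing the order. The
  products agree because the path returns to height 0.\<close>

lemma matchings_pure_copure:
  fixes x :: "'a::comm_ring_1" and S T :: "nat set"
  assumes fin: "finite S" "finite T"
  shows "(\<Sum>U \<in> matchings S T. x ^ card (pure_arcs U)) = (\<Sum>U \<in> matchings S T. x ^ card (copure_arcs U))"
proof (cases "matchings S T = {}")
  case False
  then obtain U where U: "U \<in> matchings S T" by blast
  define s where "s k = card {a \<in> S. a < k}" for k
  define t where "t k = card {b \<in> T. b < k}" for k
  have h: "t (Suc k) \<le> s k" for k
    using matchings_heights[OF U fin(1)] by (simp add: s_def t_def)
  have card: "card S = card T"
  proof -
    have "finite U" using matchings_subset[OF U] fin by (meson finite_SigmaI finite_subset)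
    then show ?thesis using U card_Domain[of U] card_Range[of U] by (simp add: matchings_def)
  qed
  have ins: "{a \<in> X. a < Suc k} = (if k \<in> X then insert k {a \<in> X. a < k} else {a \<in> X. a < k})"
    for X :: "nat set" and k by (auto simp: less_Suc_eq)
  have s_mem: "s (Suc k) = Suc (s k)" if "k \<in> S" for k
    unfolding s_def ins using fin that by simp
  have t_mem: "t (Suc k) = Suc (t k)" if "k \<in> T" for k
    unfolding t_def ins using fin that by simp
  have above: "card {a \<in> X. k < a} = card X - card {a \<in> X. a < Suc k}"
    if "finite X" for X :: "nat set" and k
  proof -
    have "{a \<in> X. k < a} = X - {a \<in> X. a < Suc k}" by auto
    then show ?thesis using that by (simp add: card_Diff_subset)
  qed
  have sS: "s (Suc k) \<le> card S" for k unfolding s_def using fin by (intro card_mono) auto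
  \<comment> \<open>As \<open>S\<close> and \<open>T\<close> have equal size, the surplus of targets
    above \<open>a\<close> is the surplus of sources up to \<open>a\<close>, the height just after
    step \<open>a\<close>.\<close>
  have heights: "card {b \<in> T. a < b} - card {c \<in> S. a < c} = s (Suc a) - t (Suc a)"
    and hall: "a \<in> S \<Longrightarrow> card {c \<in> S. a < c} < card {b \<in> T. a < b}" for a
    using h[of a] s_mem[of a] sS[of a] card unfolding above[OF fin(1)] above[OF fin(2)]
    by (simp_all add: s_def[symmetric] t_def[symmetric])
  have co_hall: "card {c \<in> T. c < b} < card {a \<in> S. a < b}" if "b \<in> T" for b
    using h[of b] t_mem[OF that] by (simp add: s_def t_def)
  \<comment> \<open>At \<open>N\<close> the whole path has been traversed, so the rising factorial
    is empty.\<close>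
  obtain N where N: "S \<union> T \<subseteq> {..<N}"
    using finite_nat_set_iff_bounded[of "S \<union> T"] fin by blast
  have "s N = card S" "t N = card T" unfolding s_def t_def using N by (auto intro!: arg_cong[of _ _ card])
  then have N0: "s N - t N = 0" using card by simp
  have "(\<Sum>U \<in> matchings S T. x ^ card (pure_arcs U)) =
      (\<Prod>a\<in>S. of_nat (s (Suc a) - t (Suc a)) + (if a \<in> T then 0 else x - 1))"
    using sum_matchings_pure_arcs[OF fin card hall, of x] unfolding heights .
  also have "\<dots> = (\<Prod>a | a \<in> S \<and> a < N. of_nat (s (Suc a) - t (Suc a)) + (if a \<in> T then 0 else x - 1))"
    using N by (intro prod.cong) auto
  also have "\<dots> = (\<Prod>b | b \<in> T \<and> b < N. of_nat (s b - t b) + (if b \<in> S then 0 else x - 1))"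
    using prod_heights[OF fin, of x N] h N0 by (simp add: s_def t_def)
  also have "\<dots> = (\<Prod>b\<in>T. of_nat (s b - t b) + (if b \<in> S then 0 else x - 1))"
    using N by (intro prod.cong) auto
  also have "\<dots> = (\<Sum>V \<in> linorder.matchings (>) T S. x ^ card (linorder.pure_arcs (\<ge>) (>) V))"
    using linorder.sum_matchings_pure_arcs[OF dual_linorder fin(2,1) card[symmetric] co_hall, of x]
    by (simp add: s_def t_def)
  also have "\<dots> = (\<Sum>U \<in> matchings S T. x ^ card (copure_arcs U))"
    unfolding dual_matchings by (subst sum.reindex) (auto simp: inj_on_def dual_pure_arcs)
  finally show ?thesis .
qed simp

section \<open>Permutations as relations\<close>

definition perm_graph :: "nat \<Rightarrow> (nat \<Rightarrow> nat) \<Rightarrow> (nat \<times> nat) set" where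
  "perm_graph n \<sigma> = (\<lambda>i. (i, \<sigma> i)) ` {1..n}"

lemma perm_graph_iff [simp]: "(a, b) \<in> perm_graph n \<sigma> \<longleftrightarrow> a \<in> {1..n} \<and> b = \<sigma> a"
  by (auto simp: perm_graph_def)

lemma perm_graph_in_partial_perms:
  assumes "\<sigma> permutes {1..n}"
  shows "perm_graph n \<sigma> \<in> partial_perms n"
proof -
  have "\<sigma> i \<in> {1..n}" if "i \<in> {1..n}" for i
    using permutes_in_image[OF assms] that by blast
  then have "perm_graph n \<sigma> \<subseteq> {1..n} \<times> {1..n}"
    unfolding perm_graph_def by blast
  moreover have "single_valued (perm_graph n \<sigma>)" by (simp add: single_valued_def)
  moreover have "single_valued ((perm_graph n \<sigma>)\<inverse>)"
    using permutes_inj[OF assms] by (auto simp: single_valued_def dest: injD)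
  ultimately show ?thesis by (simp add: partial_perms_def)
qed

lemma card_perm_graph: "card (perm_graph n \<sigma>) = n"
  unfolding perm_graph_def by (subst card_image) (auto simp: inj_on_def)

lemma perm_graph_inject:
  assumes "\<sigma> permutes {1..n}" "\<tau> permutes {1..n}" "perm_graph n \<sigma> = perm_graph n \<tau>"
  shows "\<sigma> = \<tau>"
proof
  fix i
  show "\<sigma> i = \<tau> i"
  proof (cases "i \<in> {1..n}")
    case True
    then have "(i, \<sigma> i) \<in> perm_graph n \<tau>" using assms(3)[symmetric] by simp
    then show ?thesis by simp
  next
    case False
    then show ?thesis using assms(1,2) by (simp add: permutes_not_in)
  qed
qed

lemma ex_perm_graph:
  assumes R: "R \<in> partial_perms n" "Domain R = {1..n}"
  shows "\<exists>\<sigma>. \<sigma> permutes {1..n} \<and> perm_graph n \<sigma> = R"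
proof -
  define \<sigma> where "\<sigma> i = (if i \<in> {1..n} then THE j. (i, j) \<in> R else i)" for i
  have sub: "R \<subseteq> {1..n} \<times> {1..n}" and sv: "single_valued R" and sv': "single_valued (R\<inverse>)"
    using R by (auto simp: partial_perms_def)
  have \<sigma>: "\<sigma> i = j" if "(i, j) \<in> R" for i j
    using that sub sv by (auto simp: \<sigma>_def single_valued_def)
  have arc: "(i, \<sigma> i) \<in> R" if "i \<in> {1..n}" for i
  proof -
    have "i \<in> Domain R" using that R by simp
    then obtain j where "(i, j) \<in> R" by (elim DomainE)
    then show ?thesis using \<sigma> by simp
  qed
  have "inj_on \<sigma> {1..n}"
  proof (rule inj_onI)
    fix i j assume "i \<in> {1..n}" "j \<in> {1..n}" "\<sigma> i = \<sigma> j"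
    then have "(\<sigma> i, i) \<in> R\<inverse>" "(\<sigma> i, j) \<in> R\<inverse>" using arc[of i] arc[of j] by auto
    then show "i = j" using sv' unfolding single_valued_def by blast
  qed
  moreover have "\<sigma> ` {1..n} \<subseteq> {1..n}" using arc sub by blast
  ultimately have "bij_betw \<sigma> {1..n} {1..n}"
    by (simp add: bij_betw_def endo_inj_surj)
  then have "\<sigma> permutes {1..n}"
    by (rule bij_imp_permutes) (unfold \<sigma>_def, rule if_not_P)
  moreover have "perm_graph n \<sigma> = R"
  proof (intro equalityI subrelI)
    fix i j assume "(i, j) \<in> R"
    then show "(i, j) \<in> perm_graph n \<sigma>" using \<sigma> sub by auto
  qed (use arc in auto)
  ultimately show ?thesis by blast
qed

text \<open>A partial permutation with \<open>n\<close> arcs has every element as a source, so it is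
  the graph of a permutation.\<close>

lemma sum_perm_graph:
  "(\<Sum>\<sigma> | \<sigma> permutes {1..n}. F (perm_graph n \<sigma>)) = (\<Sum>R | R \<in> partial_perms n \<and> card R = n. F R)"
proof -
  have "perm_graph n ` {\<sigma>. \<sigma> permutes {1..n}} = {R. R \<in> partial_perms n \<and> card R = n}"
  proof (intro equalityI subsetI)
    fix R assume "R \<in> {R. R \<in> partial_perms n \<and> card R = n}"
    then have R: "R \<in> partial_perms n" "card R = n" by auto
    have "Domain R = {1..n}"
    proof (rule card_subset_eq)
      show "card (Domain R) = card {1..n}"
        using R card_Domain[of R] partial_perms_finite[OF R(1)] by (simp add: partial_perms_def)
    qed (use R in \<open>auto simp: partial_perms_def\<close>)
    then obtain \<sigma> where "\<sigma> permutes {1..n}" "perm_graph n \<sigma> = R" using ex_perm_graph R by blast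
    then show "R \<in> perm_graph n ` {\<sigma>. \<sigma> permutes {1..n}}" by blast
  qed (auto simp: perm_graph_in_partial_perms card_perm_graph)
  moreover have "inj_on (perm_graph n) {\<sigma>. \<sigma> permutes {1..n}}"
    using perm_graph_inject by (auto simp: inj_on_def)
  ultimately show ?thesis by (intro sum.reindex_cong[symmetric]) auto
qed

lemma inv_in_interval:
  assumes "\<sigma> permutes {1..n}" "i \<in> {1..n}"
  shows "inv \<sigma> i \<in> {1..n}"
  using assms permutes_in_image[OF permutes_inv[OF assms(1)]] by blast

section \<open>Marked peaks as permutation statistics\<close>

lemma cycle_peak_with_perm_graph:
  assumes \<sigma>: "\<sigma> permutes {1..n}" and i: "i \<in> {1..n}"
  shows "cycle_peak_with Q i (perm_graph n \<sigma>) \<longleftrightarrow> inv \<sigma> i < i \<and> \<sigma> i < i \<and>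
    Q (i - 1) (perm_graph n \<sigma> \<inter> {1..<i} \<times> {1..<i}) (inv \<sigma> i) (\<sigma> i)"
proof -
  have "(s, i) \<in> perm_graph n \<sigma> \<longleftrightarrow> s = inv \<sigma> i" for s
    using inv_in_interval[OF \<sigma> i] permutes_inverses[OF \<sigma>] by auto
  moreover have "(i, v) \<in> perm_graph n \<sigma> \<longleftrightarrow> v = \<sigma> i" for v using i by auto
  ultimately show ?thesis unfolding cycle_peak_with_def by simp
qed

text \<open>The \<open>i - 1\<close> earlier values are distinct, positive and below
  \<open>\<sigma> i\<close>. In contrapositive form: an index with \<open>\<sigma> i < i\<close> is
  never a record.\<close>

lemma record_ge:
  assumes \<sigma>: "\<sigma> permutes {1..n}" and i: "i \<in> {1..n}" and "is_record n \<sigma> i"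
  shows "i \<le> \<sigma> i"
proof -
  have "\<sigma> ` {1..<i} \<subseteq> {1..<\<sigma> i}"
  proof clarify
    fix j assume "j \<in> {1..<i}"
    then have j: "j \<in> {1..n}" "j < i" using i by auto
    then have "\<sigma> j < \<sigma> i" using assms(3) by (simp add: is_record_def)
    moreover have "\<sigma> j \<in> {1..n}" using j permutes_in_image[OF \<sigma>] by blast
    ultimately show "\<sigma> j \<in> {1..<\<sigma> i}" by simp
  qed
  then have "card {1..<i} \<le> card {1..<\<sigma> i}"
    by (intro card_inj_on_le[of \<sigma>] permutes_inj_on[OF \<sigma>]) auto
  moreover have "\<sigma> i \<in> {1..n}" using i permutes_in_image[OF \<sigma>] by blast
  ultimately show ?thesis using i by auto
qed

lemma ear_set:
  assumes \<sigma>: "\<sigma> permutes {1..n}" and i: "i \<in> {1..n}"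
  shows "is_exclusive_antirecord n \<sigma> i \<and> is_cycle_peak \<sigma> i \<longleftrightarrow>
    is_antirecord n \<sigma> i \<and> inv \<sigma> i < i \<and> \<sigma> i < i"
proof -
  have "\<not> is_record n \<sigma> i" if "\<sigma> i < i" using record_ge[OF assms] that by linarith
  then show ?thesis unfolding is_exclusive_antirecord_def is_cycle_peak_def by blast
qed

text \<open>Below \<open>i\<close>, the values already taken when \<open>i\<close> is inserted are
  those whose preimage is less than \<open>i\<close>. So \<open>\<sigma> i\<close> is the first free
  target iff no later index has a smaller value.\<close>

lemma card_first_target_peaks:
  assumes \<sigma>: "\<sigma> permutes {1..n}"
  shows "card {i \<in> {1..n}. cycle_peak_with first_target i (perm_graph n \<sigma>)} = ear n \<sigma>"
proof -
  have "first_target (i - 1) (perm_graph n \<sigma> \<inter> {1..<i} \<times> {1..<i}) (inv \<sigma> i) (\<sigma> i)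
      \<longleftrightarrow> is_antirecord n \<sigma> i" if i: "i \<in> {1..n}" "\<sigma> i < i" for i
    unfolding first_target_def is_antirecord_def
  proof (intro iffI ballI impI subsetI)
    fix j assume sub: "{1..<\<sigma> i} \<subseteq> Range (perm_graph n \<sigma> \<inter> {1..<i} \<times> {1..<i})"
      and j: "j \<in> {1..n}" "i < j"
    show "\<sigma> i < \<sigma> j"
    proof (rule ccontr)
      assume "\<not> \<sigma> i < \<sigma> j"
      moreover have "\<sigma> i \<noteq> \<sigma> j" using j permutes_inj[OF \<sigma>] by (auto simp: inj_eq)
      moreover have "\<sigma> j \<in> {1..n}" using j permutes_in_image[OF \<sigma>] by blast
      ultimately have "\<sigma> j \<in> {1..<\<sigma> i}" by simp
      then obtain a where "a < i" "\<sigma> j = \<sigma> a" using sub by fastforce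
      then show False using j permutes_inj[OF \<sigma>] by (auto simp: inj_eq)
    qed
  next
    fix u assume anti: "\<forall>j\<in>{1..n}. i < j \<longrightarrow> \<sigma> i < \<sigma> j" and u: "u \<in> {1..<\<sigma> i}"
    let ?j = "inv \<sigma> u"
    have un: "u \<in> {1..n}" using u i by auto
    have j: "?j \<in> {1..n}" "\<sigma> ?j = u"
      using inv_in_interval[OF \<sigma> un] permutes_inverses[OF \<sigma>] by auto
    have "\<not> i < ?j" using anti j u by force
    moreover have "?j \<noteq> i" using j u by auto
    ultimately have "(?j, u) \<in> perm_graph n \<sigma> \<inter> {1..<i} \<times> {1..<i}" using j u i by auto
    then show "u \<in> Range (perm_graph n \<sigma> \<inter> {1..<i} \<times> {1..<i})" by (rule RangeI)
  qed
  then have "cycle_peak_with first_target i (perm_graph n \<sigma>) \<longleftrightarrow>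
      is_exclusive_antirecord n \<sigma> i \<and> is_cycle_peak \<sigma> i" if "i \<in> {1..n}" for i
    unfolding cycle_peak_with_perm_graph[OF \<sigma> that] ear_set[OF \<sigma> that] using that by blast
  then show ?thesis unfolding ear_def by (intro arg_cong[of _ _ card]) auto
qed

definition exc_arcs :: "nat \<Rightarrow> (nat \<Rightarrow> nat) \<Rightarrow> (nat \<times> nat) set" where
  "exc_arcs n \<sigma> = {(a, b) \<in> perm_graph n \<sigma>. a < b}"

text \<open>Copure arcs are counted by their upper end \<open>i\<close>. If \<open>(a, i)\<close> is
  copure, every \<open>c\<close> with \<open>a < c \<le> i\<close> has its image below
  \<open>i\<close>: for \<open>c = i\<close> this makes \<open>i\<close> a peak, and for the others
  it leaves \<open>a\<close> as the last free source. The converse reads the same way.\<close>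

lemma card_last_source_peaks:
  assumes \<sigma>: "\<sigma> permutes {1..n}"
  shows "card {i \<in> {1..n}. cycle_peak_with last_source i (perm_graph n \<sigma>)} = card (copure_arcs (exc_arcs n \<sigma>))"
proof -
  have "snd ` copure_arcs (exc_arcs n \<sigma>) = {i \<in> {1..n}. cycle_peak_with last_source i (perm_graph n \<sigma>)}"
  proof (intro equalityI subsetI)
    fix i assume "i \<in> snd ` copure_arcs (exc_arcs n \<sigma>)"
    then obtain a where "(a, i) \<in> copure_arcs (exc_arcs n \<sigma>)" by auto
    then have a: "a \<in> {1..n}" "\<sigma> a = i" "a < i"
      and co: "\<And>c d. (c, d) \<in> exc_arcs n \<sigma> \<Longrightarrow> i < d \<Longrightarrow> \<not> (a \<le> c \<and> c \<le> i)"
      unfolding copure_arcs_def by (auto simp: exc_arcs_def)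
    have i: "i \<in> {1..n}" using a permutes_in_image[OF \<sigma>] by blast
    have inv: "inv \<sigma> i = a" using a permutes_inv_eq[OF \<sigma>] by auto
    have lt: "\<sigma> c < i" if "a < c" "c \<le> i" for c
    proof -
      have "\<sigma> c \<noteq> i" using that a permutes_inj[OF \<sigma>] by (auto simp: inj_eq)
      moreover have "\<not> i < \<sigma> c" using co[of c "\<sigma> c"] that a(1) i by (auto simp: exc_arcs_def)
      ultimately show ?thesis by simp
    qed
    have "last_source (i - 1) (perm_graph n \<sigma> \<inter> {1..<i} \<times> {1..<i}) a (\<sigma> i)"
      unfolding last_source_def
    proof
      fix c assume c: "c \<in> {a<..i - 1}"
      then have cn: "c \<in> {1..n}" using i by auto
      then have "\<sigma> c \<in> {1..n}" using permutes_in_image[OF \<sigma>] by blast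
      then have "(c, \<sigma> c) \<in> perm_graph n \<sigma> \<inter> {1..<i} \<times> {1..<i}" using c cn lt[of c] by auto
      then show "c \<in> Domain (perm_graph n \<sigma> \<inter> {1..<i} \<times> {1..<i})" by (rule DomainI)
    qed
    then show "i \<in> {i \<in> {1..n}. cycle_peak_with last_source i (perm_graph n \<sigma>)}"
      using i a lt[of i] by (simp add: cycle_peak_with_perm_graph[OF \<sigma> i] inv)
  next
    fix i assume "i \<in> {i \<in> {1..n}. cycle_peak_with last_source i (perm_graph n \<sigma>)}"
    then have i: "i \<in> {1..n}" and peak: "cycle_peak_with last_source i (perm_graph n \<sigma>)" by auto
    let ?a = "inv \<sigma> i"
    have lt: "?a < i" "\<sigma> i < i"
      and last: "{?a<..i - 1} \<subseteq> Domain (perm_graph n \<sigma> \<inter> {1..<i} \<times> {1..<i})"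
      using peak by (auto simp: cycle_peak_with_perm_graph[OF \<sigma> i] last_source_def)
    have a: "?a \<in> {1..n}" "\<sigma> ?a = i"
      using inv_in_interval[OF \<sigma> i] permutes_inverses[OF \<sigma>] by auto
    have "\<not> i < \<sigma> c" if "?a \<le> c" "c \<le> i" for c
    proof -
      consider "c = ?a" | "c = i" | "c \<in> {?a<..i - 1}" using \<open>?a \<le> c\<close> \<open>c \<le> i\<close> by fastforce
      then show ?thesis
      proof cases
        case 3
        then have "c \<in> Domain (perm_graph n \<sigma> \<inter> {1..<i} \<times> {1..<i})" using last by blast
        then have "\<sigma> c < i" by auto
        then show ?thesis by simp
      qed (use a lt in auto)
    qed
    then have "(?a, i) \<in> copure_arcs (exc_arcs n \<sigma>)"
      using a i lt by (auto simp: copure_arcs_def exc_arcs_def)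
    then show "i \<in> snd ` copure_arcs (exc_arcs n \<sigma>)" by force
  qed
  moreover have "inj_on snd (copure_arcs (exc_arcs n \<sigma>))"
  proof (rule inj_on_subset)
    show "inj_on snd (exc_arcs n \<sigma>)"
      using permutes_inj[OF \<sigma>] by (auto simp: inj_on_def exc_arcs_def)
    show "copure_arcs (exc_arcs n \<sigma>) \<subseteq> exc_arcs n \<sigma>"
      unfolding copure_arcs_def by blast
  qed
  ultimately show ?thesis by (metis card_image)
qed

text \<open>Removing \<open>i\<close> from a longer cycle leaves a path from
  \<open>\<sigma> i\<close> to \<open>inv \<sigma> i\<close>. It stays below \<open>i\<close>
  exactly when \<open>i\<close> is the maximum of its cycle.\<close>

lemma joined_peak_iff:
  assumes \<sigma>: "\<sigma> permutes {1..n}" and i: "i \<in> {1..n}"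
  shows "cycle_peak_with joined i (perm_graph n \<sigma>) \<longleftrightarrow> \<sigma> i \<noteq> i \<and> (\<forall>x \<in> orbit \<sigma> i. x \<le> i)"
proof -
  let ?R = "perm_graph n \<sigma> \<inter> {1..<i} \<times> {1..<i}" and ?s = "inv \<sigma> i"
  have perm: "permutation \<sigma>" using \<sigma> by (auto simp: permutation_permutes)
  have s: "?s \<in> {1..n}" "\<sigma> ?s = i"
    using inv_in_interval[OF \<sigma> i] permutes_inverses[OF \<sigma>] by auto
  show ?thesis
    unfolding cycle_peak_with_perm_graph[OF \<sigma> i] joined_def
  proof (intro iffI conjI)
    assume *: "?s < i \<and> \<sigma> i < i \<and> (\<sigma> i, ?s) \<in> ?R\<^sup>*"
    then show "\<sigma> i \<noteq> i" by simp
    have "x = i \<or> (x, ?s) \<in> ?R\<^sup>*" if "x \<in> orbit \<sigma> i" for x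
      using that
    proof induction
      case base
      then show ?case using * by simp
    next
      case (step x)
      then consider "x = i" | "x = ?s" | "x \<noteq> ?s" "(x, ?s) \<in> ?R\<^sup>*" by blast
      then show ?case
      proof cases
        case 3
        then obtain z where "(x, z) \<in> ?R" "(z, ?s) \<in> ?R\<^sup>*" by (metis converse_rtranclE)
        then show ?thesis by auto
      qed (use * s in auto)
    qed
    moreover have "x < i" if "(x, ?s) \<in> ?R\<^sup>*" for x
      using that * by (cases rule: converse_rtranclE) auto
    ultimately show "\<forall>x \<in> orbit \<sigma> i. x \<le> i" by (metis less_imp_le order_refl)
  next
    assume *: "\<sigma> i \<noteq> i \<and> (\<forall>x \<in> orbit \<sigma> i. x \<le> i)"
    have "?s \<in> orbit \<sigma> i"
      using orbit.base[of "inv \<sigma>" i] orbit_inv_eq[OF perm] by simp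
    moreover have "?s \<noteq> i" using * s by auto
    ultimately show "?s < i" using * by (simp add: order.strict_iff_order)
    show "\<sigma> i < i" using * orbit.base[of \<sigma> i] by (simp add: order.strict_iff_order)
    have orb: "x \<in> {1..n}" if "x \<in> orbit \<sigma> i" for x
      using permutes_orbit_subset[OF \<sigma> i] that by blast
    have "x = i \<or> (\<sigma> i, x) \<in> ?R\<^sup>*" if "x \<in> orbit \<sigma> i" for x
      using that
    proof induction
      case (step x)
      show ?case
      proof (cases "x = i \<or> \<sigma> x = i")
        case False
        have "x < i" "\<sigma> x < i"
          using False * step.hyps orbit.step[OF step.hyps] by (simp_all add: order.strict_iff_order)
        moreover have "x \<in> {1..n}" "\<sigma> x \<in> {1..n}"
          using orb[OF step.hyps] orb[OF orbit.step[OF step.hyps]] by auto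
        ultimately have "(x, \<sigma> x) \<in> ?R" by auto
        then show ?thesis using step.IH False by (auto intro: rtrancl_into_rtrancl)
      qed auto
    qed simp
    then show "(\<sigma> i, ?s) \<in> ?R\<^sup>*" using \<open>?s \<in> orbit \<sigma> i\<close> \<open>?s \<noteq> i\<close> by blast
  qed
qed

text \<open>Each cycle is represented by its maximum, and the fixed points are split off.\<close>

lemma card_joined_peaks:
  assumes \<sigma>: "\<sigma> permutes {1..n}"
  shows "card {i \<in> {1..n}. cycle_peak_with joined i (perm_graph n \<sigma>)} = pcyc n \<sigma>"
proof -
  have perm: "permutation \<sigma>" using \<sigma> by (auto simp: permutation_permutes)
  let ?M = "{i \<in> {1..n}. \<forall>x \<in> orbit \<sigma> i. x \<le> i}" and ?F = "{i \<in> {1..n}. \<sigma> i = i}"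
  let ?C = "{i \<in> {1..n}. \<sigma> i \<noteq> i \<and> (\<forall>x \<in> orbit \<sigma> i. x \<le> i)}"
  have "orbit \<sigma> ` {1..n} = orbit \<sigma> ` ?M"
  proof
    show "orbit \<sigma> ` {1..n} \<subseteq> orbit \<sigma> ` ?M"
    proof clarify
      fix i assume i: "i \<in> {1..n}"
      let ?m = "Max (orbit \<sigma> i)"
      have fin: "finite (orbit \<sigma> i)"
        by (rule finite_orbit[OF permutation_self_in_orbit[OF perm]])
      have m: "?m \<in> orbit \<sigma> i" using fin orbit_nonempty by (rule Max_in)
      have eq: "orbit \<sigma> ?m = orbit \<sigma> i"
        using orbit_cyclic_eq3[OF cyclic_on_orbit'[OF perm] m] .
      have "?m \<in> {1..n}" using m permutes_orbit_subset[OF \<sigma> i] by blast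
      then have "?m \<in> ?M" using fin by (simp add: eq)
      then show "orbit \<sigma> i \<in> orbit \<sigma> ` ?M" using eq by (intro image_eqI[of _ _ ?m]) auto
    qed
  qed auto
  moreover have "inj_on (orbit \<sigma>) ?M"
  proof (rule inj_onI)
    fix i j assume *: "i \<in> ?M" "j \<in> ?M" "orbit \<sigma> i = orbit \<sigma> j"
    have "i \<in> orbit \<sigma> j" "j \<in> orbit \<sigma> i"
      using permutation_self_in_orbit[OF perm] *(3) by auto
    then show "i = j" using *(1,2) by (auto intro: order.antisym)
  qed
  ultimately have "cyc n \<sigma> = card ?M" by (simp add: cyc_def card_image)
  also have "?M = ?F \<union> ?C"
  proof -
    have "orbit \<sigma> i = {i}" if "\<sigma> i = i" for i using that by (simp add: orbit_eq_singleton_iff)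
    then show ?thesis by auto
  qed
  also have "card (?F \<union> ?C) = fix_num n \<sigma> + card ?C"
    by (subst card_Un_disjoint) (auto simp: fix_num_def)
  finally have "pcyc n \<sigma> = card ?C" by (simp add: pcyc_def)
  moreover have "{i \<in> {1..n}. cycle_peak_with joined i (perm_graph n \<sigma>)} = ?C"
    using joined_peak_iff[OF \<sigma>] by blast
  ultimately show ?thesis by simp
qed

lemma card_exc_arcs: "card (exc_arcs n \<sigma>) = exc n \<sigma>"
proof -
  have "exc_arcs n \<sigma> = (\<lambda>i. (i, \<sigma> i)) ` {i \<in> {1..n}. \<sigma> i > i}"
    by (auto simp: exc_arcs_def)
  then show ?thesis by (simp add: exc_def card_image inj_on_def)
qed

text \<open>An index \<open>j < i\<close> with \<open>\<sigma> j\<close> in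
  \<open>[i, \<sigma> i]\<close> satisfies \<open>j < \<sigma> j\<close>, so purity can be tested on
  excedance arcs alone.\<close>

lemma card_pure_exc_arcs: "card (pure_arcs (exc_arcs n \<sigma>)) = pex n \<sigma>"
proof -
  have "pure_arcs (exc_arcs n \<sigma>) =
      (\<lambda>i. (i, \<sigma> i)) ` {i \<in> {1..n}. \<sigma> i > i \<and> (\<forall>j \<in> {1..n}. j < i \<longrightarrow> \<sigma> j \<notin> {i..\<sigma> i})}"
    by (fastforce simp: exc_arcs_def pure_arcs_def)
  then show ?thesis by (simp add: pex_def card_image inj_on_def)
qed

section \<open>From weights to a sum over permutations\<close>

lemma A_eq_sum_permutations:
  fixes t l y w :: "'a::comm_ring_1"
  assumes peaks: "\<And>n h R. R \<in> partial_perms n \<Longrightarrow> card R + Suc h = n \<Longrightarrow>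
    (\<Sum>s \<in> {1..n} - Domain R. \<Sum>v \<in> {1..n} - Range R.
       (if Q n R s v then l else 1) * (if Q' n R s v then y else 1))
      = (l + of_nat h) * (y + of_nat h)"
  shows "A n t l y w = (\<Sum>\<sigma> | \<sigma> permutes {1..n}. t ^ exc n \<sigma>
    * l ^ card {i \<in> {1..n}. cycle_peak_with Q i (perm_graph n \<sigma>)}
    * y ^ card {i \<in> {1..n}. cycle_peak_with Q' i (perm_graph n \<sigma>)} * w ^ fix_num n \<sigma>)"
proof -
  have pow: "(\<Prod>i\<in>{1..n}. if P i then x else 1) = x ^ card {i \<in> {1..n}. P i}" for P :: "nat \<Rightarrow> bool" and x :: 'a
    by (simp add: prod.If_cases Int_def)
  have "A n t l y w = (\<Sum>R | R \<in> partial_perms n \<and> card R = n. \<Prod>i\<in>{1..n}. arc_weight Q Q' t l y w i R)"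
    by (rule sum_arc_weights[symmetric]) (rule peaks)
  also have "\<dots> = (\<Sum>\<sigma> | \<sigma> permutes {1..n}. \<Prod>i\<in>{1..n}. arc_weight Q Q' t l y w i (perm_graph n \<sigma>))"
    by (rule sum_perm_graph[of "\<lambda>R. \<Prod>i\<in>{1..n}. arc_weight Q Q' t l y w i R", symmetric])
  also have "\<dots> = (\<Sum>\<sigma> | \<sigma> permutes {1..n}. t ^ exc n \<sigma>
    * l ^ card {i \<in> {1..n}. cycle_peak_with Q i (perm_graph n \<sigma>)}
    * y ^ card {i \<in> {1..n}. cycle_peak_with Q' i (perm_graph n \<sigma>)} * w ^ fix_num n \<sigma>)"
  proof (rule sum.cong[OF refl])
    fix \<sigma> assume "\<sigma> \<in> {\<sigma>. \<sigma> permutes {1..n}}"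
    then have \<sigma>: "\<sigma> permutes {1..n}" by simp
    \<comment> \<open>The factors \<open>t\<close> sit at the values of the excedances, whereas
      \<open>exc\<close> counts positions; \<open>\<sigma>\<close> maps the positions bijectively to
      the values.\<close>
    have "{i \<in> {1..n}. \<exists>s<i. (s, i) \<in> perm_graph n \<sigma>} = \<sigma> ` {i \<in> {1..n}. \<sigma> i > i}"
      using permutes_in_image[OF \<sigma>] by auto
    then have "card {i \<in> {1..n}. \<exists>s<i. (s, i) \<in> perm_graph n \<sigma>} = exc n \<sigma>"
      by (simp only: exc_def card_image[OF permutes_inj_on[OF \<sigma>]])
    moreover have "{i \<in> {1..n}. (i, i) \<in> perm_graph n \<sigma>} = {i \<in> {1..n}. \<sigma> i = i}"
      by auto
    ultimately show "(\<Prod>i\<in>{1..n}. arc_weight Q Q' t l y w i (perm_graph n \<sigma>)) = t ^ exc n \<sigma>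
      * l ^ card {i \<in> {1..n}. cycle_peak_with Q i (perm_graph n \<sigma>)}
      * y ^ card {i \<in> {1..n}. cycle_peak_with Q' i (perm_graph n \<sigma>)} * w ^ fix_num n \<sigma>"
      unfolding arc_weight_def prod.distrib pow fix_num_def by simp
  qed
  finally show ?thesis .
qed

section \<open>Permutations with prescribed weak anti-excedances\<close>

definition weak_arcs :: "nat \<Rightarrow> (nat \<Rightarrow> nat) \<Rightarrow> (nat \<times> nat) set" where
  "weak_arcs n \<sigma> = {(a, b) \<in> perm_graph n \<sigma>. b \<le> a}"

lemma perm_graph_split: "perm_graph n \<sigma> = exc_arcs n \<sigma> \<union> weak_arcs n \<sigma>"
  by (auto simp: exc_arcs_def weak_arcs_def)

lemma weak_arcs_eqD:
  assumes "weak_arcs n \<sigma> = weak_arcs n \<tau>" "i \<in> {1..n}"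
  shows "\<sigma> i \<le> i \<longleftrightarrow> \<tau> i \<le> i" and "\<sigma> i \<le> i \<Longrightarrow> \<sigma> i = \<tau> i"
proof -
  have mem: "(i, \<sigma> i) \<in> weak_arcs n \<sigma> \<longleftrightarrow> \<sigma> i \<le> i" "(i, \<sigma> i) \<in> weak_arcs n \<tau> \<longleftrightarrow> \<sigma> i \<le> i \<and> \<sigma> i = \<tau> i"
    "(i, \<tau> i) \<in> weak_arcs n \<tau> \<longleftrightarrow> \<tau> i \<le> i" "(i, \<tau> i) \<in> weak_arcs n \<sigma> \<longleftrightarrow> \<tau> i \<le> i \<and> \<tau> i = \<sigma> i"
    using assms(2) by (auto simp: weak_arcs_def)
  show "\<sigma> i \<le> i \<longleftrightarrow> \<tau> i \<le> i" "\<sigma> i \<le> i \<Longrightarrow> \<sigma> i = \<tau> i"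
    using mem assms(1) by metis+
qed

text \<open>For \<open>ear\<close>, let \<open>\<sigma> i < i\<close>. A later excedance
  \<open>j\<close> has value above \<open>j > i > \<sigma> i\<close>, so the antirecord condition
  concerns only weak arcs; and \<open>inv \<sigma> i < i\<close> says that no weak arc ends at
  \<open>i\<close>.\<close>

lemma weak_arcs_stats:
  assumes \<sigma>: "\<sigma> permutes {1..n}" and \<tau>: "\<tau> permutes {1..n}" and eq: "weak_arcs n \<sigma> = weak_arcs n \<tau>"
  shows "exc n \<sigma> = exc n \<tau>" and "fix_num n \<sigma> = fix_num n \<tau>" and "ear n \<sigma> = ear n \<tau>"
proof -
  have "\<sigma> i > i \<longleftrightarrow> \<tau> i > i" if "i \<in> {1..n}" for i
    using weak_arcs_eqD(1)[OF eq that] by (simp add: not_le[symmetric])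
  then show "exc n \<sigma> = exc n \<tau>"
    unfolding exc_def by (intro arg_cong[of _ _ card]) blast
  have "\<sigma> i = i \<longleftrightarrow> \<tau> i = i" if "i \<in> {1..n}" for i
    using weak_arcs_eqD[OF eq that] by auto
  then show "fix_num n \<sigma> = fix_num n \<tau>"
    unfolding fix_num_def by (intro arg_cong[of _ _ card]) blast
  have imp: "is_antirecord n \<tau> i \<and> inv \<tau> i < i \<and> \<tau> i < i"
    if \<sigma>: "\<sigma> permutes {1..n}" and \<tau>: "\<tau> permutes {1..n}" and eq: "weak_arcs n \<sigma> = weak_arcs n \<tau>"
      and i: "i \<in> {1..n}" and *: "is_antirecord n \<sigma> i \<and> inv \<sigma> i < i \<and> \<sigma> i < i" for \<sigma> \<tau> i
  proof (intro conjI)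
    have \<tau>i: "\<tau> i = \<sigma> i" using weak_arcs_eqD(2)[OF eq i] * by simp
    then show "\<tau> i < i" using * by simp
    show "is_antirecord n \<tau> i"
      unfolding is_antirecord_def
    proof (intro ballI impI)
      fix j assume j: "j \<in> {1..n}" "i < j"
      show "\<tau> i < \<tau> j"
      proof (cases "\<tau> j \<le> j")
        case True
        then have "\<tau> j = \<sigma> j" using weak_arcs_eqD[OF eq j(1)] by simp
        then show ?thesis using * j \<tau>i by (simp add: is_antirecord_def)
      next
        case False
        then show ?thesis using j * \<tau>i by simp
      qed
    qed
    show "inv \<tau> i < i"
    proof (rule ccontr)
      let ?s = "inv \<tau> i"
      assume "\<not> ?s < i"
      moreover have s: "?s \<in> {1..n}" "\<tau> ?s = i"
        using inv_in_interval[OF \<tau> i] permutes_inverses[OF \<tau>] by auto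
      ultimately have "\<sigma> ?s = i" using weak_arcs_eqD[OF eq s(1)] by simp
      then have "inv \<sigma> i = ?s" using permutes_inv_eq[OF \<sigma>] by blast
      then show False using \<open>\<not> ?s < i\<close> * by simp
    qed
  qed
  have "is_exclusive_antirecord n \<sigma> i \<and> is_cycle_peak \<sigma> i \<longleftrightarrow>
      is_exclusive_antirecord n \<tau> i \<and> is_cycle_peak \<tau> i" if "i \<in> {1..n}" for i
    unfolding ear_set[OF \<sigma> that] ear_set[OF \<tau> that]
    using imp[OF \<sigma> \<tau> eq that] imp[OF \<tau> \<sigma> eq[symmetric] that] by blast
  then show "ear n \<sigma> = ear n \<tau>"
    unfolding ear_def by (intro arg_cong[of _ _ card]) blast
qed

text \<open>The excedances must match the sources left over by \<open>L\<close> to the targets left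
  over. Conversely such a matching together with \<open>L\<close> is the graph of a permutation, and
  comparing the two ends of each arc recovers both parts.\<close>

lemma exc_arcs_bij_matchings:
  assumes \<sigma>: "\<sigma> permutes {1..n}"
  defines "L \<equiv> weak_arcs n \<sigma>"
  shows "bij_betw (exc_arcs n) {\<tau>. \<tau> permutes {1..n} \<and> weak_arcs n \<tau> = L}
    (matchings ({1..n} - Domain L) ({1..n} - Range L))"
  unfolding bij_betw_def
proof
  let ?\<Phi> = "{\<tau>. \<tau> permutes {1..n} \<and> weak_arcs n \<tau> = L}"
  show "inj_on (exc_arcs n) ?\<Phi>"
  proof (rule inj_onI)
    fix \<tau> \<tau>' assume \<tau>: "\<tau> \<in> ?\<Phi>" "\<tau>' \<in> ?\<Phi>" and eq: "exc_arcs n \<tau> = exc_arcs n \<tau>'"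
    then have "perm_graph n \<tau> = perm_graph n \<tau>'" by (simp add: perm_graph_split)
    then show "\<tau> = \<tau>'" using perm_graph_inject \<tau> by blast
  qed
  show "exc_arcs n ` ?\<Phi> = matchings ({1..n} - Domain L) ({1..n} - Range L)"
  proof (intro equalityI subsetI)
    fix U assume "U \<in> exc_arcs n ` ?\<Phi>"
    then obtain \<tau> where \<tau>: "\<tau> permutes {1..n}" and L: "L = weak_arcs n \<tau>" and U: "U = exc_arcs n \<tau>"
      by auto
    have mem: "(a, b) \<in> U \<longleftrightarrow> a \<in> {1..n} \<and> b = \<tau> a \<and> a < b"
      "(a, b) \<in> L \<longleftrightarrow> a \<in> {1..n} \<and> b = \<tau> a \<and> b \<le> a" for a b
      by (auto simp: U L exc_arcs_def weak_arcs_def)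
    have inj: "\<tau> a = \<tau> b \<longleftrightarrow> a = b" for a b using permutes_inj[OF \<tau>] by (simp add: inj_eq)
    have "a \<in> Domain U \<longleftrightarrow> a \<in> {1..n} - Domain L" for a
      by (auto simp: Domain_iff mem not_le)
    moreover have "b \<in> Range U \<longleftrightarrow> b \<in> {1..n} - Range L" for b
    proof
      assume "b \<in> Range U"
      then obtain a where a: "a \<in> {1..n}" "b = \<tau> a" "a < b" by (auto simp: mem)
      moreover have "b \<in> {1..n}" using a permutes_in_image[OF \<tau>] by blast
      ultimately show "b \<in> {1..n} - Range L" by (auto simp: mem inj)
    next
      assume b: "b \<in> {1..n} - Range L"
      let ?a = "inv \<tau> b"
      have a: "?a \<in> {1..n}" "\<tau> ?a = b"
        using b inv_in_interval[OF \<tau>, of b] permutes_inverses[OF \<tau>] by auto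
      have "(?a, b) \<notin> L" using b by blast
      then have "(?a, b) \<in> U" using a by (auto simp: mem)
      then show "b \<in> Range U" by (rule RangeI)
    qed
    moreover have "single_valued U" "single_valued (U\<inverse>)" "\<forall>(a, b) \<in> U. a < b"
      by (auto simp: single_valued_def mem inj)
    ultimately show "U \<in> matchings ({1..n} - Domain L) ({1..n} - Range L)"
      unfolding matchings_def by blast
  next
    fix U assume U: "U \<in> matchings ({1..n} - Domain L) ({1..n} - Range L)"
    have sub: "L \<subseteq> perm_graph n \<sigma>" unfolding L_def weak_arcs_def by blast
    then have sub': "L\<inverse> \<subseteq> (perm_graph n \<sigma>)\<inverse>" by blast
    note graph = perm_graph_in_partial_perms[OF \<sigma>, unfolded partial_perms_def mem_Collect_eq]
    have L: "L \<subseteq> {1..n} \<times> {1..n}" "single_valued L" "single_valued (L\<inverse>)"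
      using graph sub by (blast, metis single_valued_subset, metis sub' single_valued_subset)
    have L_le: "\<And>a b. (a, b) \<in> L \<Longrightarrow> b \<le> a" unfolding L_def weak_arcs_def by blast
    have U': "Domain U = {1..n} - Domain L" "Range U = {1..n} - Range L"
      "single_valued U" "single_valued (U\<inverse>)" "\<And>a b. (a, b) \<in> U \<Longrightarrow> a < b"
      using U unfolding matchings_def by blast+
    have disj: "a \<notin> Domain L" "b \<notin> Range L" if "(a, b) \<in> U" for a b
      using DomainI[OF that] RangeI[OF that] U' by auto
    have "U \<subseteq> {1..n} \<times> {1..n}" using matchings_subset[OF U] by blast
    moreover have "single_valued (U \<union> L)" "single_valued ((U \<union> L)\<inverse>)"
      using U'(3,4) L(2,3) disj unfolding single_valued_def by blast+
    ultimately have "U \<union> L \<in> partial_perms n" using L(1) unfolding partial_perms_def by simp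
    moreover have "Domain (U \<union> L) = {1..n}" using U'(1) L(1) by auto
    ultimately obtain \<tau> where \<tau>: "\<tau> permutes {1..n}" "perm_graph n \<tau> = U \<union> L"
      using ex_perm_graph by blast
    have "exc_arcs n \<tau> = U" "weak_arcs n \<tau> = L"
      unfolding exc_arcs_def weak_arcs_def \<tau>(2) using U'(5) L_le by fastforce+
    then show "U \<in> exc_arcs n ` ?\<Phi>" using \<tau>(1) by blast
  qed
qed

text \<open>Group the permutations by their weak arcs. On each group \<open>g\<close> is constant
  and the excedance arcs run through all matchings of two fixed sets.\<close>

lemma sum_pure_eq_sum_copure:
  fixes x :: "'a::comm_ring_1"
  assumes const: "\<And>\<sigma> \<tau>. \<sigma> permutes {1..n} \<Longrightarrow> \<tau> permutes {1..n} \<Longrightarrow>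
    weak_arcs n \<sigma> = weak_arcs n \<tau> \<Longrightarrow> g \<sigma> = g \<tau>"
  shows "(\<Sum>\<sigma> | \<sigma> permutes {1..n}. x ^ card (pure_arcs (exc_arcs n \<sigma>)) * g \<sigma>) =
    (\<Sum>\<sigma> | \<sigma> permutes {1..n}. x ^ card (copure_arcs (exc_arcs n \<sigma>)) * g \<sigma>)"
proof -
  let ?P = "{\<sigma>. \<sigma> permutes {1..n}}" and ?W = "weak_arcs n"
  have fin: "finite ?P" by (simp add: finite_permutations)
  have "(\<Sum>\<tau> | \<tau> \<in> ?P \<and> ?W \<tau> = L. x ^ card (pure_arcs (exc_arcs n \<tau>)) * g \<tau>) =
      (\<Sum>\<tau> | \<tau> \<in> ?P \<and> ?W \<tau> = L. x ^ card (copure_arcs (exc_arcs n \<tau>)) * g \<tau>)"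
    if L: "L \<in> ?W ` ?P" for L
  proof -
    obtain \<sigma> where \<sigma>: "\<sigma> permutes {1..n}" "L = ?W \<sigma>" using L by blast
    let ?\<Phi> = "{\<tau>. \<tau> permutes {1..n} \<and> ?W \<tau> = L}"
    let ?M = "matchings ({1..n} - Domain L) ({1..n} - Range L)"
    have red: "(\<Sum>\<tau> | \<tau> \<in> ?P \<and> ?W \<tau> = L. x ^ f (exc_arcs n \<tau>) * g \<tau>) = (\<Sum>U \<in> ?M. x ^ f U) * g \<sigma>"
      for f :: "(nat \<times> nat) set \<Rightarrow> nat"
    proof -
      have "(\<Sum>\<tau> | \<tau> \<in> ?P \<and> ?W \<tau> = L. x ^ f (exc_arcs n \<tau>) * g \<tau>) = (\<Sum>\<tau> \<in> ?\<Phi>. x ^ f (exc_arcs n \<tau>) * g \<sigma>)"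
        using const[OF _ \<sigma>(1)] \<sigma>(2) by (intro sum.cong) auto
      also have "\<dots> = (\<Sum>\<tau> \<in> ?\<Phi>. x ^ f (exc_arcs n \<tau>)) * g \<sigma>"
        by (rule sum_distrib_right[symmetric])
      also have "(\<Sum>\<tau> \<in> ?\<Phi>. x ^ f (exc_arcs n \<tau>)) = (\<Sum>U \<in> ?M. x ^ f U)"
        by (rule sum.reindex_bij_betw[OF exc_arcs_bij_matchings[OF \<sigma>(1), folded \<sigma>(2)], of "\<lambda>U. x ^ f U"])
      finally show ?thesis .
    qed
    show ?thesis
      unfolding red[of "\<lambda>U. card (pure_arcs U)"] red[of "\<lambda>U. card (copure_arcs U)"]
      by (subst matchings_pure_copure) simp_all
  qed
  then show ?thesis
    using sum.image_gen[OF fin, of "\<lambda>\<sigma>. x ^ card (pure_arcs (exc_arcs n \<sigma>)) * g \<sigma>" ?W]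
      sum.image_gen[OF fin, of "\<lambda>\<sigma>. x ^ card (copure_arcs (exc_arcs n \<sigma>)) * g \<sigma>" ?W]
    by (simp only: cong: sum.cong)
qed

section \<open>Reflection\<close>

text \<open>Being the identity outside \<open>{1..n}\<close>, it is an involution on all naturals
  and conjugation by it preserves \<open>permutes\<close>.\<close>

definition reflect :: "nat \<Rightarrow> nat \<Rightarrow> nat" where
  "reflect n i = (if i \<in> {1..n} then n + 1 - i else i)"

lemma reflect_reflect [simp]: "reflect n (reflect n i) = i"
  by (auto simp: reflect_def)

lemma reflect_in_interval [simp]: "reflect n i \<in> {1..n} \<longleftrightarrow> i \<in> {1..n}"
  by (auto simp: reflect_def)

lemma reflect_less: "i \<in> {1..n} \<Longrightarrow> j \<in> {1..n} \<Longrightarrow> reflect n i < reflect n j \<longleftrightarrow> j < i"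
  by (auto simp: reflect_def)

lemma reflect_le: "i \<in> {1..n} \<Longrightarrow> j \<in> {1..n} \<Longrightarrow> reflect n i \<le> reflect n j \<longleftrightarrow> j \<le> i"
  by (auto simp: reflect_def)

lemma reflect_permutes: "reflect n permutes {1..n}"
proof (rule bij_imp_permutes)
  show "bij_betw (reflect n) {1..n} {1..n}"
    by (rule bij_betw_byWitness[of _ "reflect n"]) (auto simp: reflect_def)
qed (unfold reflect_def, rule if_not_P)

text \<open>The reverse complement of the inverse. On graphs it is the reflection in the
  antidiagonal, taking \<open>(i, j)\<close> to \<open>(n + 1 - j, n + 1 - i)\<close>, so excedances
  go to excedances.\<close>

definition rc_inverse :: "nat \<Rightarrow> (nat \<Rightarrow> nat) \<Rightarrow> nat \<Rightarrow> nat" where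
  "rc_inverse n \<sigma> = reflect n \<circ> inv \<sigma> \<circ> reflect n"

lemma rc_inverse_permutes: "\<sigma> permutes {1..n} \<Longrightarrow> rc_inverse n \<sigma> permutes {1..n}"
  unfolding rc_inverse_def
  by (intro permutes_compose permutes_inv reflect_permutes)

lemma rc_inverse_rc_inverse:
  assumes \<sigma>: "\<sigma> permutes {1..n}"
  shows "rc_inverse n (rc_inverse n \<sigma>) = \<sigma>"
proof -
  have "inv (rc_inverse n \<sigma>) = reflect n \<circ> \<sigma> \<circ> reflect n"
    by (rule inv_unique_comp) (auto simp: rc_inverse_def fun_eq_iff permutes_inverses[OF \<sigma>])
  then show ?thesis by (auto simp: rc_inverse_def[of n "rc_inverse n \<sigma>"] fun_eq_iff)
qed

definition reflect_arc :: "nat \<Rightarrow> nat \<times> nat \<Rightarrow> nat \<times> nat" where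
  "reflect_arc n = (\<lambda>(a, b). (reflect n b, reflect n a))"

lemma inj_reflect_arc: "inj_on (reflect_arc n) R"
  by (rule inj_on_inverseI[of _ "reflect_arc n"]) (auto simp: reflect_arc_def)

lemma reflect_arc_image_iff: "(a, b) \<in> reflect_arc n ` R \<longleftrightarrow> (reflect n b, reflect n a) \<in> R"
  by (force simp: reflect_arc_def image_iff)

lemma exc_arcs_rc_inverse:
  assumes \<sigma>: "\<sigma> permutes {1..n}"
  shows "exc_arcs n (rc_inverse n \<sigma>) = reflect_arc n ` exc_arcs n \<sigma>"
proof -
  have "a \<in> {1..n} \<and> b = rc_inverse n \<sigma> a \<and> a < b \<longleftrightarrow>
      reflect n b \<in> {1..n} \<and> reflect n a = \<sigma> (reflect n b) \<and> reflect n b < reflect n a" for a b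
  proof -
    have "b = rc_inverse n \<sigma> a \<longleftrightarrow> reflect n a = \<sigma> (reflect n b)"
      unfolding rc_inverse_def o_def
      by (metis permutes_inverses[OF \<sigma>] reflect_reflect)
    moreover have "a \<in> {1..n} \<longleftrightarrow> b \<in> {1..n}" if "reflect n a = \<sigma> (reflect n b)"
      using that permutes_in_image[OF \<sigma>, of "reflect n b"] by (metis reflect_in_interval)
    ultimately show ?thesis using reflect_less[of b n a] by (metis reflect_in_interval)
  qed
  then have "(a, b) \<in> exc_arcs n (rc_inverse n \<sigma>) \<longleftrightarrow> (a, b) \<in> reflect_arc n ` exc_arcs n \<sigma>" for a b
    unfolding reflect_arc_image_iff exc_arcs_def mem_Collect_eq case_prod_conv perm_graph_iff
    by blast
  then show ?thesis by (intro equalityI subrelI) blast+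
qed

text \<open>Reversing the order and swapping ends turns an arc that starts below \<open>a\<close>
  and ends in \<open>[a, b]\<close> into one that starts in the reflected interval and ends beyond
  it. Order is reversed only inside \<open>{1..n}\<close>, hence the hypothesis.\<close>

lemma copure_arcs_reflect:
  assumes "U \<subseteq> {1..n} \<times> {1..n}"
  shows "copure_arcs (reflect_arc n ` U) = reflect_arc n ` pure_arcs U"
proof -
  have "(\<forall>(c, d) \<in> reflect_arc n ` U. reflect n a < d \<longrightarrow> \<not> (reflect n b \<le> c \<and> c \<le> reflect n a)) \<longleftrightarrow>
      (\<forall>(c, d) \<in> U. c < a \<longrightarrow> \<not> (a \<le> d \<and> d \<le> b))" if "(a, b) \<in> U" for a b
  proof -
    have *: "(\<forall>(c, d) \<in> reflect_arc n ` U. P c d) \<longleftrightarrow> (\<forall>(c, d) \<in> U. P (reflect n d) (reflect n c))" for P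
      by (auto simp: reflect_arc_def)
    show ?thesis
      unfolding * using assms that
      by (intro ball_cong refl) (auto simp: reflect_less reflect_le subset_iff)
  qed
  then have "(a, b) \<in> pure_arcs U \<longleftrightarrow> reflect_arc n (a, b) \<in> copure_arcs (reflect_arc n ` U)" for a b
    unfolding pure_arcs_def copure_arcs_def reflect_arc_def[of n] mem_Collect_eq case_prod_conv
    unfolding reflect_arc_def[symmetric] reflect_arc_image_iff reflect_reflect by blast
  moreover have "reflect_arc n (reflect_arc n p) = p" for p
    by (simp add: reflect_arc_def case_prod_unfold)
  ultimately show ?thesis
    by (intro equalityI subsetI) (metis imageI surj_pair, metis imageE surj_pair)
qed

lemma card_copure_rc_inverse:
  assumes "\<sigma> permutes {1..n}"
  shows "card (copure_arcs (exc_arcs n (rc_inverse n \<sigma>))) = pex n \<sigma>"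
proof -
  have "exc_arcs n \<sigma> \<subseteq> {1..n} \<times> {1..n}"
    using perm_graph_in_partial_perms[OF assms] unfolding exc_arcs_def partial_perms_def by blast
  then show ?thesis
    unfolding exc_arcs_rc_inverse[OF assms]
    by (simp only: copure_arcs_reflect card_image[OF inj_reflect_arc] card_pure_exc_arcs)
qed

lemma exc_rc_inverse: "\<sigma> permutes {1..n} \<Longrightarrow> exc n (rc_inverse n \<sigma>) = exc n \<sigma>"
  by (simp only: card_exc_arcs[symmetric] exc_arcs_rc_inverse card_image[OF inj_reflect_arc])

lemma fix_num_rc_inverse:
  assumes \<sigma>: "\<sigma> permutes {1..n}"
  shows "fix_num n (rc_inverse n \<sigma>) = fix_num n \<sigma>"
proof -
  have fixed: "rc_inverse n \<sigma> i = i \<longleftrightarrow> \<sigma> (reflect n i) = reflect n i" for i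
    unfolding rc_inverse_def o_def by (metis permutes_inverses[OF \<sigma>] reflect_reflect)
  have "bij_betw (reflect n) {i \<in> {1..n}. rc_inverse n \<sigma> i = i} {i \<in> {1..n}. \<sigma> i = i}"
    unfolding fixed
    by (rule bij_betw_byWitness[of _ "reflect n"]) (auto simp del: atLeastAtMost_iff One_nat_def)
  then show ?thesis unfolding fix_num_def by (rule bij_betw_same_card)
qed

lemma orbit_conj_subset:
  assumes "\<And>i. r (r i) = i" "y \<in> orbit f (r x)"
  shows "r y \<in> orbit (r \<circ> f \<circ> r) x"
  using assms(2)
proof induction
  case base
  show ?case using orbit.base[of "r \<circ> f \<circ> r" x] by (simp add: o_def)
next
  case (step y)
  show ?case using orbit.step[OF step.IH] assms(1) by (simp add: o_def)
qed

lemma orbit_conj: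
  assumes r: "\<And>i. r (r i) = i"
  shows "orbit (r \<circ> f \<circ> r) x = r ` orbit f (r x)"
proof (intro equalityI subsetI)
  fix y assume "y \<in> orbit (r \<circ> f \<circ> r) x"
  then have "y \<in> orbit (r \<circ> f \<circ> r) (r (r x))" by (simp add: r)
  from orbit_conj_subset[OF r this] have "r y \<in> orbit (r \<circ> (r \<circ> f \<circ> r) \<circ> r) (r x)" .
  moreover have "r \<circ> (r \<circ> f \<circ> r) \<circ> r = f" by (auto simp: r)
  ultimately have "r y \<in> orbit f (r x)" by simp
  then show "y \<in> r ` orbit f (r x)" using r by (metis imageI)
qed (use orbit_conj_subset[OF r] in blast)

text \<open>Inversion leaves orbits unchanged, and conjugation by the reflection replaces them by
  their images, so cycles correspond bijectively.\<close>

lemma pcyc_rc_inverse: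
  assumes \<sigma>: "\<sigma> permutes {1..n}"
  shows "pcyc n (rc_inverse n \<sigma>) = pcyc n \<sigma>"
proof -
  have perm: "permutation \<sigma>" using \<sigma> by (auto simp: permutation_permutes)
  have inj: "inj (reflect n)" by (rule inj_on_inverseI[of _ "reflect n"]) simp
  have "reflect n ` {1..n} = {1..n}" by (rule permutes_image[OF reflect_permutes])
  then have "orbit (rc_inverse n \<sigma>) ` {1..n} = (`) (reflect n) ` orbit \<sigma> ` {1..n}"
    unfolding rc_inverse_def by (simp add: orbit_conj orbit_inv_eq[OF perm] image_image[symmetric]
      flip: image_image[of "\<lambda>x. reflect n ` orbit \<sigma> x" "reflect n"])
  then have "cyc n (rc_inverse n \<sigma>) = cyc n \<sigma>"
    unfolding cyc_def by (simp only:) (rule card_image, rule inj_on_image, rule inj_on_subset[OF inj], simp)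
  then show ?thesis by (simp add: pcyc_def fix_num_rc_inverse[OF \<sigma>])
qed

section \<open>The three expansions from three markings of peaks\<close>

theorem theorem1p3:
  fixes t l y w :: "'a::comm_ring_1" and n :: nat
  shows "A n t l y w =
           (\<Sum>\<sigma> | \<sigma> permutes {1..n}. t ^ exc n \<sigma> * l ^ pex n \<sigma> * y ^ ear n \<sigma> * w ^ fix_num n \<sigma>)
       \<and> (\<Sum>\<sigma> | \<sigma> permutes {1..n}. t ^ exc n \<sigma> * l ^ pex n \<sigma> * y ^ ear n \<sigma> * w ^ fix_num n \<sigma>) =
           (\<Sum>\<sigma> | \<sigma> permutes {1..n}. t ^ exc n \<sigma> * l ^ pcyc n \<sigma> * y ^ ear n \<sigma> * w ^ fix_num n \<sigma>)
       \<and> (\<Sum>\<sigma> | \<sigma> permutes {1..n}. t ^ exc n \<sigma> * l ^ pcyc n \<sigma> * y ^ ear n \<sigma> * w ^ fix_num n \<sigma>) =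
           (\<Sum>\<sigma> | \<sigma> permutes {1..n}. t ^ exc n \<sigma> * l ^ pcyc n \<sigma> * y ^ pex n \<sigma> * w ^ fix_num n \<sigma>)"
proof -
  let ?P = "{\<sigma>. \<sigma> permutes {1..n}}"
  let ?co = "\<lambda>\<sigma>. card (copure_arcs (exc_arcs n \<sigma>))"
  have "A n t l y w = (\<Sum>\<sigma>\<in>?P. t ^ exc n \<sigma> * l ^ ?co \<sigma> * y ^ ear n \<sigma> * w ^ fix_num n \<sigma>)"
    by (subst A_eq_sum_permutations[OF sum_peaks_last_source_first_target], assumption+)
      (simp add: card_last_source_peaks card_first_target_peaks del: atLeastAtMost_iff One_nat_def)
  also have "\<dots> = (\<Sum>\<sigma>\<in>?P. l ^ ?co \<sigma> * (t ^ exc n \<sigma> * y ^ ear n \<sigma> * w ^ fix_num n \<sigma>))"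
    by (simp only: mult_ac)
  also have "\<dots> = (\<Sum>\<sigma>\<in>?P. l ^ card (pure_arcs (exc_arcs n \<sigma>)) * (t ^ exc n \<sigma> * y ^ ear n \<sigma> * w ^ fix_num n \<sigma>))"
  \<comment> \<open>\<open>exc\<close>, \<open>ear\<close> and \<open>fix_num\<close> are determined
    by the weak arcs, so copure arcs may be exchanged for pure ones.\<close>
  proof (rule sum_pure_eq_sum_copure[symmetric])
    fix \<sigma> \<tau> assume "\<sigma> permutes {1..n}" "\<tau> permutes {1..n}" "weak_arcs n \<sigma> = weak_arcs n \<tau>"
    from weak_arcs_stats[OF this]
    show "t ^ exc n \<sigma> * y ^ ear n \<sigma> * w ^ fix_num n \<sigma> = t ^ exc n \<tau> * y ^ ear n \<tau> * w ^ fix_num n \<tau>"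
      by simp
  qed
  also have "\<dots> = (\<Sum>\<sigma>\<in>?P. t ^ exc n \<sigma> * l ^ pex n \<sigma> * y ^ ear n \<sigma> * w ^ fix_num n \<sigma>)"
    by (simp only: card_pure_exc_arcs mult_ac)
  finally have pex_ear: "A n t l y w = \<dots>" .
  have pcyc_ear: "A n t l y w = (\<Sum>\<sigma>\<in>?P. t ^ exc n \<sigma> * l ^ pcyc n \<sigma> * y ^ ear n \<sigma> * w ^ fix_num n \<sigma>)"
    by (subst A_eq_sum_permutations[OF sum_peaks_joined_first_target], assumption+)
      (simp add: card_joined_peaks card_first_target_peaks del: atLeastAtMost_iff One_nat_def)
  have "A n t l y w = (\<Sum>\<sigma>\<in>?P. t ^ exc n \<sigma> * l ^ pcyc n \<sigma> * y ^ ?co \<sigma> * w ^ fix_num n \<sigma>)"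
    by (subst A_eq_sum_permutations[OF sum_peaks_joined_last_source], assumption+)
      (simp add: card_joined_peaks card_last_source_peaks del: atLeastAtMost_iff One_nat_def)
  also have "\<dots> = (\<Sum>\<sigma>\<in>?P. t ^ exc n \<sigma> * l ^ pcyc n \<sigma> * y ^ pex n \<sigma> * w ^ fix_num n \<sigma>)"
    \<comment> \<open>\<open>pcyc\<close> is not determined by the weak arcs; here the involution,
      which preserves \<open>exc\<close>, \<open>pcyc\<close> and \<open>fix_num\<close>, exchanges
      copure and pure arcs.\<close>
    by (rule sum.reindex_bij_witness[of _ "rc_inverse n" "rc_inverse n"])
      (simp_all add: rc_inverse_permutes rc_inverse_rc_inverse exc_rc_inverse pcyc_rc_inverse
        fix_num_rc_inverse flip: card_copure_rc_inverse del: atLeastAtMost_iff One_nat_def)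
  finally have pcyc_pex: "A n t l y w = \<dots>" .
  show ?thesis using pex_ear pcyc_ear pcyc_pex by metis
qed

end
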